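(* There exist affine planar vector fields $X(\cdot,\alpha)$ and $Y(\cdot,\alpha)$ on $\mathbb{R}^2$, depending on a parameter $\alpha\in\mathbb{R}$, such that the following is true: for any integer $k>0$, there exist a non-monotonic transition function $\varphi_k:\mathbb{R}\to\mathbb{R}$, with precisely $1$ critical point in $(-1,1)$, and a smooth function $a_k:[0,\varepsilon_k]\to\mathbb{R}$, with $\varepsilon_k>0$ small enough and $a_k(0)=0$, such that, for each $\varepsilon\in(0,\varepsilon_k]$, the $\varphi_k$-linear regularization $$Z_\varepsilon(x,y)=\frac{1+\varphi_k\left(\frac{x}{\varepsilon}\right)}{2}X(x,y,\alpha)+\frac{1-\varphi_k\left(\frac{x}{\varepsilon}\right)}{2}Y(x,y,\alpha)\quad\text{with }\alpha=\varepsilon a_k(\varepsilon)$$ has at least $k+1$ hyperbolic limit cycles.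
   Context: A transition function is a $C^\infty$-smooth function $\varphi:\mathbb{R}\to\mathbb{R}$ with $\varphi(t)=-1$ for $t\le -1$ and $\varphi(t)=1$ for $t\ge 1$. It is called monotonic if in addition $\varphi'(t)>0$ for all $t\in(-1,1)$, and non-monotonic otherwise. A critical point of $\varphi$ is a point $t$ with $\varphi'(t)=0$. For planar vector fields $X,Y$ and a transition function $\varphi$, the $\varphi$-linear regularization of the piecewise vector field equal to $X$ for $x>0$ and $Y$ for $x<0$ is the family, for $\varepsilon>0$, of smooth vector fields $Z_\varepsilon(x,y)=\frac{1+\varphi(x/\varepsilon)}{2}X(x,y)+\frac{1-\varphi(x/\varepsilon)}{2}Y(x,y)$ on $\mathbb{R}^2$. A limit cycle is an isolated periodic orbit; it is hyperbolic if the derivative of its Poincaré return map at the corresponding fixed point is different from $1$. Smooth means $C^\infty$. *)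

theory Defs
  imports "HOL-Analysis.Analysis"
begin

text \<open>
  Derivatives are taken within \<open>S\<close>, hence one-sided at an end point of a closed
  interval. \<open>S\<close> is meant to be a nondegenerate interval or \<open>UNIV\<close>.
\<close>

definition smooth_on :: "real set \<Rightarrow> (real \<Rightarrow> 'a::real_normed_vector) \<Rightarrow> bool" where
  "smooth_on S f \<longleftrightarrow>
     (\<exists>D :: nat \<Rightarrow> real \<Rightarrow> 'a.
        (\<forall>t\<in>S. D 0 t = f t) \<and>
        (\<forall>n. \<forall>t\<in>S. (D n has_vector_derivative D (Suc n) t) (at t within S)))"

definition transition_function :: "(real \<Rightarrow> real) \<Rightarrow> bool" where
  "transition_function \<phi> \<longleftrightarrow>
     smooth_on UNIV \<phi> \<and> (\<forall>t\<le>-1. \<phi> t = -1) \<and> (\<forall>t\<ge>1. \<phi> t = 1)"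

definition monotonic_transition_function :: "(real \<Rightarrow> real) \<Rightarrow> bool" where
  "monotonic_transition_function \<phi> \<longleftrightarrow>
     transition_function \<phi> \<and> (\<forall>t\<in>{-1<..<1}. deriv \<phi> t > 0)"

definition non_monotonic_transition_function :: "(real \<Rightarrow> real) \<Rightarrow> bool" where
  "non_monotonic_transition_function \<phi> \<longleftrightarrow>
     transition_function \<phi> \<and> \<not> monotonic_transition_function \<phi>"

definition critical_point :: "(real \<Rightarrow> real) \<Rightarrow> real \<Rightarrow> bool" where
  "critical_point \<phi> t \<longleftrightarrow> deriv \<phi> t = 0"

type_synonym planar_field = "real \<times> real \<Rightarrow> real \<times> real"

definition affine_field :: "planar_field \<Rightarrow> bool" where
  "affine_field F \<longleftrightarrow> (\<exists>L c. linear L \<and> F = (\<lambda>z. L z + c))"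

text \<open>
  A family \<open>X z \<alpha>\<close> depends smoothly on \<open>\<alpha>\<close>; since it is affine in \<open>z\<close>, smoothness in
  \<open>\<alpha>\<close> for each fixed \<open>z\<close> says that all its coefficients are smooth functions of \<open>\<alpha>\<close>.
\<close>

definition affine_family :: "(real \<times> real \<Rightarrow> real \<Rightarrow> real \<times> real) \<Rightarrow> bool" where
  "affine_family X \<longleftrightarrow>
     (\<forall>\<alpha>. affine_field (\<lambda>z. X z \<alpha>)) \<and> (\<forall>z. smooth_on UNIV (X z))"

definition linear_regularization ::
    "(real \<Rightarrow> real) \<Rightarrow> planar_field \<Rightarrow> planar_field \<Rightarrow> real \<Rightarrow> planar_field" where
  "linear_regularization \<phi> X Y \<epsilon> =
     (\<lambda>(x, y). ((1 + \<phi> (x / \<epsilon>)) / 2) *\<^sub>R X (x, y) + ((1 - \<phi> (x / \<epsilon>)) / 2) *\<^sub>R Y (x, y))"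

definition solution_on :: "planar_field \<Rightarrow> real set \<Rightarrow> (real \<Rightarrow> real \<times> real) \<Rightarrow> bool" where
  "solution_on F I \<gamma> \<longleftrightarrow> (\<forall>t\<in>I. (\<gamma> has_vector_derivative F (\<gamma> t)) (at t within I))"

text \<open>Equilibria are not periodic orbits, so constant solutions are excluded.\<close>

definition periodic_orbit :: "planar_field \<Rightarrow> (real \<times> real) set \<Rightarrow> bool" where
  "periodic_orbit F \<Gamma> \<longleftrightarrow>
     (\<exists>\<gamma> T. solution_on F UNIV \<gamma> \<and> T > 0 \<and> (\<forall>t. \<gamma> (t + T) = \<gamma> t) \<and>
            (\<exists>t. \<gamma> t \<noteq> \<gamma> 0) \<and> \<Gamma> = range \<gamma>)"

definition limit_cycle :: "planar_field \<Rightarrow> (real \<times> real) set \<Rightarrow> bool" where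
  "limit_cycle F \<Gamma> \<longleftrightarrow>
     periodic_orbit F \<Gamma> \<and>
     (\<exists>U. open U \<and> \<Gamma> \<subseteq> U \<and> (\<forall>\<Gamma>'. periodic_orbit F \<Gamma>' \<and> \<Gamma>' \<inter> U \<noteq> {} \<longrightarrow> \<Gamma>' = \<Gamma>))"

definition section_segment :: "real \<times> real \<Rightarrow> real \<times> real \<Rightarrow> real \<Rightarrow> (real \<times> real) set" where
  "section_segment p v r = (\<lambda>s. p + s *\<^sub>R v) ` {-r<..<r}"

definition transversal :: "planar_field \<Rightarrow> real \<times> real \<Rightarrow> (real \<times> real) set \<Rightarrow> bool" where
  "transversal F v \<Sigma> \<longleftrightarrow> (\<forall>z\<in>\<Sigma>. fst (F z) * snd v - snd (F z) * fst v \<noteq> 0)"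

text \<open>
  \<open>first_return F p v r s s'\<close>: the forward orbit of \<open>p + s v\<close> next meets the segment
  \<open>{p + u v | \<bar>u\<bar> < r}\<close> at \<open>p + s' v\<close>.
\<close>

definition first_return ::
    "planar_field \<Rightarrow> real \<times> real \<Rightarrow> real \<times> real \<Rightarrow> real \<Rightarrow> real \<Rightarrow> real \<Rightarrow> bool" where
  "first_return F p v r s s' \<longleftrightarrow>
     \<bar>s'\<bar> < r \<and>
     (\<exists>\<gamma> \<tau>. \<tau> > 0 \<and> solution_on F {0..\<tau>} \<gamma> \<and>
            \<gamma> 0 = p + s *\<^sub>R v \<and> \<gamma> \<tau> = p + s' *\<^sub>R v \<and>
            (\<forall>t\<in>{0<..<\<tau>}. \<gamma> t \<notin> section_segment p v r))"

text \<open>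
  \<open>P\<close> is the Poincare return map, near its fixed point \<open>0\<close>, of the transversal segment
  through \<open>p\<close> in direction \<open>v\<close>, written in the coordinate \<open>s\<close> of \<open>p + s v\<close>.
\<close>

definition poincare_map ::
    "planar_field \<Rightarrow> real \<times> real \<Rightarrow> real \<times> real \<Rightarrow> (real \<Rightarrow> real) \<Rightarrow> bool" where
  "poincare_map F p v P \<longleftrightarrow>
     P 0 = 0 \<and>
     (\<exists>r \<delta>. 0 < \<delta> \<and> \<delta> \<le> r \<and> transversal F v (section_segment p v r) \<and>
            (\<forall>s\<in>{-\<delta><..<\<delta>}. first_return F p v r s (P s)))"

text \<open>
  The derivative of the return map at the fixed point does not depend on the point
  \<open>p\<close> of the orbit or on the section through it, so one section is enough.
\<close>

definition hyperbolic_limit_cycle :: "planar_field \<Rightarrow> (real \<times> real) set \<Rightarrow> bool" where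
  "hyperbolic_limit_cycle F \<Gamma> \<longleftrightarrow>
     limit_cycle F \<Gamma> \<and>
     (\<exists>p\<in>\<Gamma>. \<exists>v P d. poincare_map F p v P \<and> (P has_real_derivative d) (at 0) \<and> d \<noteq> 1)"

end

theory Submission
  imports Defs
begin

text \<open>
  Let \<open>J\<close> be the quarter turn of the plane and take the linear fields \<open>X z = J z + z\<close> and
  \<open>Y z = J z - z\<close>, constant in \<open>\<alpha>\<close>, with \<open>a = 0\<close>. The regularization is \<open>J z + \<phi> (x/\<epsilon>) z\<close>. It is
  homogeneous: the scaling \<open>z \<mapsto> \<epsilon> z\<close> carries the case \<open>\<epsilon> = 1\<close> to any other one, so a single
  \<open>\<phi>\<close> serves all \<open>\<epsilon>\<close> alike. Moreover every orbit turns around the origin with unit speed. With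
  \<open>z = \<epsilon> e\<^sup>W (cos t, sin t)\<close> the planar system becomes the scalar \<open>2\<pi>\<close>-periodic equation
  \<open>W' = \<phi> (e\<^sup>W cos t)\<close>; limit cycles are isolated fixed points of its period map, and they are
  hyperbolic if the derivative of the period map differs from \<open>1\<close>
  (\<open>solution_on_imp_angular_solution\<close>, \<open>foci_hyperbolic_limit_cycle\<close>).

  On \<open>[-1/2, 1/2]\<close> let \<open>\<phi> = \<delta> p\<close> with a polynomial \<open>p\<close> and a small \<open>\<delta> > 0\<close>. For orbits in the disc
  of radius \<open>\<epsilon>/2\<close> the equation is a small perturbation of \<open>W' = 0\<close>, and averaging applies: the
  displacement over one turn is \<open>\<delta>\<close> times \<open>\<integral> p (r cos t) dt\<close> up to \<open>O(\<delta>\<^sup>2)\<close>, and each simple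
  positive zero \<open>r\<close> of this mean is continued to one hyperbolic fixed point (\<open>averaged_cycle\<close>). The
  mean can be any prescribed even polynomial in \<open>r\<close>, for instance one with \<open>k + 1\<close> simple
  positive zeros (\<open>circle_mean_simple_zeros\<close>).

  The odd part of \<open>p\<close> does not affect the mean, so a large linear term can be added to make \<open>p\<close>
  increasing. Then \<open>\<delta> p\<close> extends to a nondecreasing transition function whose only critical point
  in \<open>(-1, 1)\<close> is a horizontal inflection at \<open>3/4\<close>, away from the region used by the cycles
  (\<open>transition_function_extending\<close>).
\<close>

section \<open>Smooth functions and smooth steps\<close>

text \<open>
  Counting derivatives makes closure of smoothness under sums, products and affine
  substitutions a plain induction; no derivative of order \<open>n\<close> has to be written down.
\<close>

primrec differentiable_times :: "nat \<Rightarrow> (real \<Rightarrow> real) \<Rightarrow> bool" where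
  "differentiable_times 0 f \<longleftrightarrow> True"
| "differentiable_times (Suc n) f \<longleftrightarrow>
     (\<exists>f'. (\<forall>x. (f has_real_derivative f' x) (at x)) \<and> differentiable_times n f')"

lemma differentiable_times_SucI:
  assumes "\<And>x. (f has_real_derivative f' x) (at x)" "differentiable_times n f'"
  shows "differentiable_times (Suc n) f"
  using assms by auto

lemma differentiable_times_Suc_mono:
  "differentiable_times (Suc n) f \<Longrightarrow> differentiable_times n f"
proof (induction n arbitrary: f)
  case (Suc n)
  then obtain f' where "\<forall>x. (f has_real_derivative f' x) (at x)" "differentiable_times (Suc n) f'"
    by (metis differentiable_times.simps(2))
  with Suc.IH show ?case by auto
qed simp

lemma differentiable_times_add:
  "differentiable_times n f \<Longrightarrow> differentiable_times n g \<Longrightarrow> differentiable_times n (\<lambda>x. f x + g x)"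
proof (induction n arbitrary: f g)
  case (Suc n)
  from Suc.prems obtain f' g' where
    f: "\<And>x. (f has_real_derivative f' x) (at x)" "differentiable_times n f'" and
    g: "\<And>x. (g has_real_derivative g' x) (at x)" "differentiable_times n g'"
    by auto
  show ?case
    by (rule differentiable_times_SucI[OF _ Suc.IH[OF f(2) g(2)]]) (intro DERIV_add f(1) g(1))
qed simp

lemma differentiable_times_mult:
  "differentiable_times n f \<Longrightarrow> differentiable_times n g \<Longrightarrow> differentiable_times n (\<lambda>x. f x * g x)"
proof (induction n arbitrary: f g)
  case (Suc n)
  from Suc.prems obtain f' g' where
    f: "\<And>x. (f has_real_derivative f' x) (at x)" "differentiable_times n f'" and
    g: "\<And>x. (g has_real_derivative g' x) (at x)" "differentiable_times n g'"
    by auto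
  have "differentiable_times n f" "differentiable_times n g"
    using Suc.prems differentiable_times_Suc_mono by blast+
  then have "differentiable_times n (\<lambda>x. f' x * g x + g' x * f x)"
    by (intro differentiable_times_add Suc.IH f(2) g(2))
  moreover have "((\<lambda>x. f x * g x) has_real_derivative f' x * g x + g' x * f x) (at x)" for x
    by (intro DERIV_mult f(1) g(1))
  ultimately show ?case by (rule differentiable_times_SucI[rotated])
qed simp

lemma differentiable_times_poly: "differentiable_times n (poly p)"
proof (induction n arbitrary: p)
  case (Suc n)
  then show ?case by (intro differentiable_times_SucI[OF poly_DERIV])
qed simp

lemma differentiable_times_const: "differentiable_times n (\<lambda>x. c)"
proof -
  have "poly [:c:] = (\<lambda>x. c)" by auto
  with differentiable_times_poly[of n "[:c:]"] show ?thesis by simp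
qed

lemma differentiable_times_affine:
  "differentiable_times n f \<Longrightarrow> differentiable_times n (\<lambda>x. f (a * x + b))"
proof (induction n arbitrary: f)
  case (Suc n)
  from Suc.prems obtain f' where
    f: "\<And>x. (f has_real_derivative f' x) (at x)" "differentiable_times n f'"
    by auto
  have "((\<lambda>x. f (a * x + b)) has_real_derivative f' (a * x + b) * a) (at x)" for x
    by (rule DERIV_chain2[where g = "\<lambda>x. a * x + b", OF f(1)])
       (auto intro!: derivative_eq_intros)
  then show ?case
    by (rule differentiable_times_SucI)
       (intro differentiable_times_mult differentiable_times_const Suc.IH f(2))
qed simp

lemma smooth_on_UNIV_I:
  assumes "\<And>n. differentiable_times n f"
  shows "smooth_on UNIV f"
proof -
  define S where "S = {f. \<forall>n. differentiable_times n f}"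
  have step: "(\<forall>x. (f has_real_derivative deriv f x) (at x)) \<and> deriv f \<in> S" if "f \<in> S" for f
  proof -
    have "\<exists>f'. (\<forall>x. (f has_real_derivative f' x) (at x)) \<and> differentiable_times n f'" for n
      using that differentiable_times.simps(2) unfolding S_def by blast
    then obtain f' where
      f': "\<And>n x. (f has_real_derivative f' n x) (at x)" "\<And>n. differentiable_times n (f' n)"
      by metis
    then have "f' n = deriv f" for n
      by (intro ext) (metis DERIV_imp_deriv)
    with f' show ?thesis by (auto simp: S_def)
  qed
  have "(deriv ^^ n) f \<in> S" for n
    by (induction n) (use assms step in \<open>auto simp: S_def\<close>)
  then show ?thesis
    unfolding smooth_on_def
    by (intro exI[of _ "\<lambda>n. (deriv ^^ n) f"])
       (use step in \<open>auto simp: has_real_derivative_iff_has_vector_derivative\<close>)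
qed

text \<open>
  The functions \<open>p (1/x) exp (- 1/x)\<close> for \<open>x > 0\<close>, extended by \<open>0\<close>. Letting \<open>p\<close> range over
  all polynomials gives a class that contains the classical flat function (\<open>p = 1\<close>) and is
  closed under differentiation, so each of its members is smooth.
\<close>

definition flat_exp :: "real poly \<Rightarrow> real \<Rightarrow> real" where
  "flat_exp p x = (if x > 0 then poly p (1 / x) * exp (- (1 / x)) else 0)"

lemma flat_exp_tendsto_0: "((\<lambda>x. poly p (1 / x) * exp (- (1 / x))) \<longlongrightarrow> 0) (at_right (0::real))"
proof -
  have "((\<lambda>y::real. y ^ n * exp (- y)) \<longlongrightarrow> 0) at_top" for n
    using tendsto_power_div_exp_0[of n] by (simp add: exp_minus divide_inverse)
  then have "((\<lambda>y. \<Sum>i\<le>degree p. coeff p i * (y ^ i * exp (- y))) \<longlongrightarrow> 0) at_top"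
    by (intro tendsto_null_sum tendsto_mult_right_zero)
  then have "((\<lambda>y. poly p y * exp (- y)) \<longlongrightarrow> 0) at_top"
    by (simp add: poly_altdef sum_distrib_right mult.assoc)
  from filterlim_compose[OF this filterlim_inverse_at_top_right]
  show ?thesis by (simp add: divide_inverse)
qed

lemma DERIV_flat_exp:
  "(flat_exp p has_real_derivative flat_exp ([:0, 0, 1:] * (p - pderiv p)) x) (at x)"
proof -
  consider "x > 0" | "x < 0" | "x = 0" by linarith
  then show ?thesis
  proof cases
    case 1
    have inv: "((\<lambda>x. 1 / x) has_real_derivative - ((1 / x) ^ 2)) (at x)"
      using 1 by (auto intro!: derivative_eq_intros simp: power2_eq_square)
    have "((\<lambda>x. poly p (1 / x) * exp (- (1 / x))) has_real_derivative
             poly (pderiv p) (1 / x) * - ((1 / x) ^ 2) * exp (- (1 / x))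
             + exp (- (1 / x)) * (1 / x) ^ 2 * poly p (1 / x)) (at x)"
      using DERIV_mult[OF DERIV_chain2[where g = "\<lambda>x. 1 / x", OF poly_DERIV inv]
              DERIV_chain2[where g = "\<lambda>x. - (1 / x)", OF DERIV_exp DERIV_minus[OF inv]]]
      by simp
    also have "poly (pderiv p) (1 / x) * - ((1 / x) ^ 2) * exp (- (1 / x))
        + exp (- (1 / x)) * (1 / x) ^ 2 * poly p (1 / x)
      = poly ([:0, 0, 1:] * (p - pderiv p)) (1 / x) * exp (- (1 / x))"
      by (simp add: algebra_simps power2_eq_square del: times_divide_eq_left times_divide_eq_right)
    moreover have "\<forall>\<^sub>F y in nhds x. flat_exp p y = poly p (1 / y) * exp (- (1 / y))"
      using eventually_gt_at_top 1 by (auto simp: flat_exp_def eventually_nhds intro!: exI[of _ "{0<..}"])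
    ultimately show ?thesis
      using 1 by (subst DERIV_cong_ev[OF refl _ refl]) (auto simp: flat_exp_def)
  next
    case 2
    moreover have "\<forall>\<^sub>F y in nhds x. flat_exp p y = 0"
      using 2 by (auto simp: flat_exp_def eventually_nhds intro!: exI[of _ "{..<0}"])
    ultimately show ?thesis
      by (subst DERIV_cong_ev[OF refl _ refl, where g = "\<lambda>_. 0"]) (auto simp: flat_exp_def)
  next
    case 3
    have "((\<lambda>y. flat_exp p y / y) \<longlongrightarrow> 0) (at_right 0)"
      by (rule Lim_transform_eventually[OF flat_exp_tendsto_0[of "[:0,1:] * p"]])
         (auto simp: flat_exp_def eventually_at_filter)
    moreover have "((\<lambda>y. flat_exp p y / y) \<longlongrightarrow> 0) (at_left 0)"
      by (rule Lim_transform_eventually[of "\<lambda>_. 0"])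
         (auto simp: flat_exp_def eventually_at_filter)
    ultimately have "((\<lambda>y. flat_exp p y / y) \<longlongrightarrow> 0) (at 0)"
      by (simp add: filterlim_split_at)
    then show ?thesis
      using 3 by (simp add: has_field_derivative_iff flat_exp_def)
  qed
qed

lemma differentiable_times_flat_exp: "differentiable_times n (flat_exp p)"
proof (induction n arbitrary: p)
  case (Suc n)
  then show ?case by (intro differentiable_times_SucI[OF DERIV_flat_exp])
qed simp

lemma has_antiderivative_real:
  fixes f :: "real \<Rightarrow> real"
  assumes "\<And>x. isCont f x"
  obtains F where "\<And>x. (F has_real_derivative f x) (at x)"
proof -
  have "\<exists>F. \<forall>x. -\<infinity> < ereal x \<longrightarrow> ereal x < \<infinity> \<longrightarrow> (F has_vector_derivative f x) (at x)"
    by (rule einterval_antiderivative) (use assms in auto)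
  then show ?thesis
    using that by (auto simp: has_real_derivative_iff_has_vector_derivative)
qed

text \<open>
  The end points may come in either order; this is how locally constant pieces of
  antiderivatives are recognised below.
\<close>

lemma DERIV_0_interval_imp_eq:
  fixes f :: "real \<Rightarrow> real"
  assumes "\<And>x. (f has_real_derivative f' x) (at x)" "\<And>x. min a b < x \<Longrightarrow> x < max a b \<Longrightarrow> f' x = 0"
  shows "f a = f b"
proof -
  have *: "f a = f b" if ab: "a < b" and z: "\<And>x. a < x \<Longrightarrow> x < b \<Longrightarrow> f' x = 0" for a b
  proof -
    obtain z where "a < z" "z < b" "f b - f a = (b - a) * f' z"
      using MVT2[OF ab, of f f'] assms(1) by blast
    with z show ?thesis by simp
  qed
  show ?thesis
  proof (rule linorder_cases[of a b])
    assume "a < b"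
    then show ?thesis by (rule *) (use assms(2) \<open>a < b\<close> in auto)
  next
    assume "b < a"
    then have "f b = f a" by (rule *) (use assms(2) \<open>b < a\<close> in auto)
    then show ?thesis ..
  qed simp
qed

text \<open>
  \<open>\<sigma>\<close> is the normalised antiderivative of the bump \<open>flat_exp 1 x * flat_exp 1 (1 - x)\<close>, which is
  positive exactly on \<open>(0, 1)\<close>. Integrating a bump keeps full control over the sign of \<open>\<sigma>'\<close>,
  which decides the critical points of the transition function assembled from \<open>\<sigma>\<close>.
\<close>

lemma smooth_step:
  obtains \<sigma> \<sigma>' :: "real \<Rightarrow> real" where
    "\<And>n. differentiable_times n \<sigma>"
    "\<And>x. (\<sigma> has_real_derivative \<sigma>' x) (at x)"
    "\<And>x. x \<le> 0 \<Longrightarrow> \<sigma> x = 0" "\<And>x. x > 0 \<Longrightarrow> \<sigma> x > 0" "\<And>x. x \<ge> 1 \<Longrightarrow> \<sigma> x = 1"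
    "\<And>x. 0 < x \<Longrightarrow> x < 1 \<Longrightarrow> \<sigma>' x > 0" "\<And>x. x \<le> 0 \<or> x \<ge> 1 \<Longrightarrow> \<sigma>' x = 0"
proof -
  define \<beta> where "\<beta> x = flat_exp 1 x * flat_exp 1 (-1 * x + 1)" for x
  have \<beta>: "differentiable_times n \<beta>" for n
    unfolding \<beta>_def
    by (intro differentiable_times_mult differentiable_times_affine differentiable_times_flat_exp)
  have \<beta>_pos: "\<beta> x > 0" if "0 < x" "x < 1" for x
    using that by (simp add: \<beta>_def flat_exp_def)
  have \<beta>_0: "\<beta> x = 0" if "x \<le> 0 \<or> x \<ge> 1" for x
    using that by (auto simp: \<beta>_def flat_exp_def)
  have "isCont \<beta> x" for x
    using \<beta>[of 1] DERIV_isCont by auto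
  then obtain F where F: "\<And>x. (F has_real_derivative \<beta> x) (at x)"
    using has_antiderivative_real by blast
  have mono: "F a < F b" if ab: "0 \<le> a" "a < b" "b \<le> 1" for a b
  proof -
    obtain z where "a < z" "z < b" "F b - F a = (b - a) * \<beta> z"
      using MVT2[OF ab(2), of F \<beta>] F by blast
    moreover from this ab have "(b - a) * \<beta> z > 0" by (intro mult_pos_pos \<beta>_pos) auto
    ultimately show ?thesis by linarith
  qed
  define c where "c = 1 / (F 1 - F 0)"
  have c: "c > 0" using mono[of 0 1] by (simp add: c_def)
  define \<sigma> where "\<sigma> x = c * F x + (- c * F 0)" for x
  have d: "(\<sigma> has_real_derivative c * \<beta> x) (at x)" for x
    unfolding \<sigma>_def by (auto intro!: derivative_eq_intros F)
  have s0: "\<sigma> x = 0" if "x \<le> 0" for x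
  proof -
    have "\<sigma> x = \<sigma> 0" by (rule DERIV_0_interval_imp_eq[OF d]) (use that \<beta>_0 in auto)
    then show ?thesis by (simp add: \<sigma>_def)
  qed
  have s1: "\<sigma> x = 1" if "x \<ge> 1" for x
  proof -
    have "\<sigma> x = \<sigma> 1" by (rule DERIV_0_interval_imp_eq[OF d]) (use that \<beta>_0 in auto)
    also have "\<dots> = c * (F 1 - F 0)" by (simp add: \<sigma>_def algebra_simps)
    also have "\<dots> = 1" using c by (auto simp: c_def)
    finally show ?thesis .
  qed
  have s2: "\<sigma> x > 0" if "x > 0" for x
  proof (cases "x < 1")
    case True
    then have "c * (F x - F 0) > 0" using mono[of 0 x] that c by simp
    then show ?thesis by (simp add: \<sigma>_def algebra_simps)
  qed (use s1 in auto)
  have "differentiable_times (Suc n) \<sigma>" for n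
    by (rule differentiable_times_SucI[OF d]) (intro differentiable_times_mult differentiable_times_const \<beta>)
  then have "differentiable_times n \<sigma>" for n
    using differentiable_times_Suc_mono by blast
  from this d s0 s2 s1 show thesis
    by (rule that) (use c \<beta>_pos \<beta>_0 in auto)
qed

section \<open>Transition functions with one inflection\<close>

text \<open>
  Integrate a nonnegative density with three pieces: \<open>\<delta> p'\<close>, cut off smoothly outside
  \<open>[-3/4, 3/4]\<close>, and two positive bumps on \<open>(-1, -1/2)\<close> and \<open>(3/4, 1)\<close> that make up the height
  missing on the left and on the right. The left bump overlaps the first piece while the right
  one only touches it, so the density vanishes in \<open>(-1, 1)\<close> at the single point \<open>3/4\<close>: the
  function increases, but has a horizontal inflection there. Smallness of \<open>\<delta>\<close> guarantees that
  the missing heights \<open>A\<close> and \<open>B\<close> are positive.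
\<close>

lemma transition_function_extending:
  fixes p :: "real poly"
  assumes pos: "\<And>x. \<bar>x\<bar> \<le> 1 \<Longrightarrow> poly (pderiv p) x > 0"
  obtains \<delta>0 where "\<delta>0 > 0"
    "\<And>\<delta>. 0 < \<delta> \<Longrightarrow> \<delta> \<le> \<delta>0 \<Longrightarrow> \<exists>\<phi>.
       non_monotonic_transition_function \<phi> \<and>
       card {t \<in> {-1<..<1}. critical_point \<phi> t} = 1 \<and>
       mono \<phi> \<and> (\<forall>x. \<bar>x\<bar> \<le> 1/2 \<longrightarrow> \<phi> x = \<delta> * poly p x)"
proof -
  obtain \<sigma> \<sigma>' :: "real \<Rightarrow> real" where
    \<sigma>: "\<And>n. differentiable_times n \<sigma>" "\<And>x. (\<sigma> has_real_derivative \<sigma>' x) (at x)"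
       "\<And>x. x \<le> 0 \<Longrightarrow> \<sigma> x = 0" "\<And>x. x > 0 \<Longrightarrow> \<sigma> x > 0" "\<And>x. x \<ge> 1 \<Longrightarrow> \<sigma> x = 1"
       "\<And>x. 0 < x \<Longrightarrow> x < 1 \<Longrightarrow> \<sigma>' x > 0" "\<And>x. x \<le> 0 \<or> x \<ge> 1 \<Longrightarrow> \<sigma>' x = 0"
    using smooth_step by blast
  have \<sigma>'_nonneg: "\<sigma>' x \<ge> 0" for x
    using \<sigma>(6,7)[of x] by (cases "0 < x \<and> x < 1") auto
  define cut where "cut x = \<sigma> (-4 * x + 3) * \<sigma> (4 * x + 3)" for x
  have cut1: "cut x = 1" if "\<bar>x\<bar> \<le> 1/2" for x
    using that \<sigma>(5)[of "-4 * x + 3"] \<sigma>(5)[of "4 * x + 3"] by (auto simp: cut_def)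
  have cut0: "cut x = 0" if "\<bar>x\<bar> \<ge> 3/4" for x
    using that \<sigma>(3)[of "-4 * x + 3"] \<sigma>(3)[of "4 * x + 3"] by (cases "x \<ge> 0") (auto simp: cut_def)
  have cut_pos: "cut x > 0" if "\<bar>x\<bar> < 3/4" for x
    unfolding cut_def using that by (intro mult_pos_pos \<sigma>(4)) auto
  define h where "h x = cut x * poly (pderiv p) x" for x
  have h_smooth: "differentiable_times n h" for n
    unfolding h_def cut_def
    by (intro differentiable_times_mult differentiable_times_affine differentiable_times_poly \<sigma>(1))
  have h0: "h x = 0" if "\<bar>x\<bar> \<ge> 3/4" for x using cut0[OF that] by (simp add: h_def)
  have h_pos: "h x > 0" if "\<bar>x\<bar> < 3/4" for x
    unfolding h_def using that by (intro mult_pos_pos cut_pos pos) auto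
  have "isCont h x" for x
    using h_smooth[of 1] DERIV_isCont by auto
  then obtain H0 where H0: "\<And>x. (H0 has_real_derivative h x) (at x)"
    using has_antiderivative_real by blast
  define H where "H x = H0 x + (poly p 0 - H0 0)" for x
  have H: "(H has_real_derivative h x) (at x)" for x
    unfolding H_def by (auto intro!: derivative_eq_intros H0)
  have H_smooth: "differentiable_times n H" for n
    using differentiable_times_SucI[OF H h_smooth, of n] differentiable_times_Suc_mono by blast
  have H_right: "H x = H 1" if "x \<ge> 3/4" for x
    by (rule DERIV_0_interval_imp_eq[OF H]) (use that h0 in \<open>auto simp: min_def max_def split: if_splits\<close>)
  have H_left: "H x = H (-1)" if "x \<le> -3/4" for x
    by (rule DERIV_0_interval_imp_eq[OF H]) (use that h0 in \<open>auto simp: min_def max_def split: if_splits\<close>)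
  have H_inner: "H x = poly p x" if "\<bar>x\<bar> \<le> 1/2" for x
  proof -
    have "H x - poly p x = H 0 - poly p 0"
      by (rule DERIV_0_interval_imp_eq[where f = "\<lambda>x. H x - poly p x"
            and f' = "\<lambda>x. h x - poly (pderiv p) x"])
         (use that cut1 in \<open>auto intro!: derivative_eq_intros H poly_DERIV simp: h_def min_def max_def split: if_splits\<close>)
    then show ?thesis by (simp add: H_def)
  qed
  \<comment> \<open>ensures \<open>\<bar>\<delta> H 1\<bar>, \<bar>\<delta> H (-1)\<bar> \<le> 1/2\<close>, so that the heights \<open>A\<close> and \<open>B\<close> below are positive\<close>
  define \<delta>0 where "\<delta>0 = 1 / (2 * (1 + \<bar>H 1\<bar> + \<bar>H (-1)\<bar>))"
  have "\<delta>0 > 0" by (simp add: \<delta>0_def add_nonneg_pos)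
  moreover have "\<exists>\<phi>. non_monotonic_transition_function \<phi> \<and>
       card {t \<in> {-1<..<1}. critical_point \<phi> t} = 1 \<and>
       mono \<phi> \<and> (\<forall>x. \<bar>x\<bar> \<le> 1/2 \<longrightarrow> \<phi> x = \<delta> * poly p x)" if \<delta>: "0 < \<delta>" "\<delta> \<le> \<delta>0" for \<delta>
  proof -
    have \<delta>H: "\<bar>\<delta> * H s\<bar> \<le> 1/2" if "s = 1 \<or> s = -1" for s
    proof -
      have "\<bar>\<delta> * H s\<bar> \<le> \<delta>0 * (1 + \<bar>H 1\<bar> + \<bar>H (-1)\<bar>)"
        unfolding abs_mult using \<delta> that by (intro mult_mono) auto
      also have "\<dots> = 1/2" by (simp add: \<delta>0_def field_simps add_nonneg_eq_0_iff)
      finally show ?thesis .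
    qed
    define A where "A = 1 + \<delta> * H (-1)"
    define B where "B = 1 - \<delta> * H 1"
    have AB: "A > 0" "B > 0" using \<delta>H[of 1] \<delta>H[of "-1"] by (auto simp: A_def B_def)
    define \<phi> where "\<phi> x = \<delta> * H x + (A * \<sigma> (2 * x + 2) + (B * \<sigma> (4 * x + (-3)) + (- A)))" for x
    define \<phi>' where "\<phi>' x = \<delta> * h x + (A * (2 * \<sigma>' (2 * x + 2)) + B * (4 * \<sigma>' (4 * x - 3)))" for x
    have d: "(\<phi> has_real_derivative \<phi>' x) (at x)" for x
      unfolding \<phi>_def \<phi>'_def
      by (auto intro!: derivative_eq_intros H DERIV_chain2[OF \<sigma>(2)])
    then have deriv: "deriv \<phi> x = \<phi>' x" for x by (rule DERIV_imp_deriv)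
    have "differentiable_times n \<phi>" for n
      unfolding \<phi>_def
      by (intro differentiable_times_add differentiable_times_mult differentiable_times_const
            differentiable_times_affine H_smooth \<sigma>(1))
    then have "smooth_on UNIV \<phi>" by (rule smooth_on_UNIV_I)
    moreover have "\<phi> t = -1" if "t \<le> -1" for t
      using that H_left[of t] \<sigma>(3)[of "2 * t + 2"] \<sigma>(3)[of "4 * t + (-3)"] by (simp add: \<phi>_def A_def)
    moreover have "\<phi> t = 1" if "t \<ge> 1" for t
      using that H_right[of t] \<sigma>(5)[of "2 * t + 2"] \<sigma>(5)[of "4 * t + (-3)"] by (simp add: \<phi>_def B_def)
    ultimately have trans: "transition_function \<phi>" by (simp add: transition_function_def)
    have h_nonneg: "h x \<ge> 0" for x using h0[of x] h_pos[of x] by (cases "\<bar>x\<bar> < 3/4") auto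
    have nonneg: "\<phi>' x \<ge> 0" for x
      unfolding \<phi>'_def using h_nonneg \<sigma>'_nonneg \<delta> AB by (intro add_nonneg_nonneg mult_nonneg_nonneg) auto
    have crit: "\<phi>' x = 0 \<longleftrightarrow> x = 3/4" if "-1 < x" "x < 1" for x
    proof -
      consider "\<bar>x\<bar> < 3/4" | "x \<le> -3/4" | "x = 3/4" | "x > 3/4" by linarith
      then show ?thesis
      proof cases
        case 1
        then have "\<delta> * h x > 0" using h_pos \<delta> by simp
        moreover have "A * (2 * \<sigma>' (2 * x + 2)) \<ge> 0" "B * (4 * \<sigma>' (4 * x - 3)) \<ge> 0"
          using AB \<sigma>'_nonneg by auto
        ultimately show ?thesis unfolding \<phi>'_def using 1 by auto
      next
        case 2
        then have "A * (2 * \<sigma>' (2 * x + 2)) > 0" using \<sigma>(6)[of "2 * x + 2"] AB that by simp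
        moreover have "\<delta> * h x \<ge> 0" "B * (4 * \<sigma>' (4 * x - 3)) \<ge> 0"
          using AB \<delta> h_nonneg \<sigma>'_nonneg by auto
        ultimately show ?thesis unfolding \<phi>'_def using 2 by auto
      next
        case 3
        then show ?thesis using h0[of x] \<sigma>(7)[of "2 * x + 2"] \<sigma>(7)[of "4 * x - 3"] by (simp add: \<phi>'_def)
      next
        case 4
        then have "B * (4 * \<sigma>' (4 * x - 3)) > 0" using \<sigma>(6)[of "4 * x - 3"] AB that by simp
        moreover have "\<delta> * h x \<ge> 0" "A * (2 * \<sigma>' (2 * x + 2)) \<ge> 0"
          using AB \<delta> h_nonneg \<sigma>'_nonneg by auto
        ultimately show ?thesis unfolding \<phi>'_def using 4 by auto
      qed
    qed
    have "{t \<in> {-1<..<1}. critical_point \<phi> t} = {3/4}"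
      using crit by (auto simp: critical_point_def deriv)
    moreover have "\<not> monotonic_transition_function \<phi>"
      unfolding monotonic_transition_function_def deriv using crit[of "3/4"]
      by (auto intro!: bexI[of _ "3/4"])
    moreover have "mono \<phi>"
      by (rule monoI) (use d nonneg in \<open>blast intro: DERIV_nonneg_imp_nondecreasing\<close>)
    moreover have "\<phi> x = \<delta> * poly p x" if "\<bar>x\<bar> \<le> 1/2" for x
      using that H_inner[OF that] \<sigma>(5)[of "2 * x + 2"] \<sigma>(3)[of "4 * x + (-3)"] by (auto simp: \<phi>_def)
    ultimately show ?thesis
      using trans by (auto simp: non_monotonic_transition_function_def)
  qed
  ultimately show thesis using that by blast
qed

text \<open>
  In logarithmic coordinates the derivative of the right hand side is \<open>x \<phi>' x\<close>, which is bounded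
  because \<open>\<phi>'\<close> vanishes outside \<open>[-1, 1]\<close>. Hence solutions of the angular equation are unique
  without any restriction on their size.
\<close>

lemma transition_function_exp_Lipschitz:
  assumes "transition_function \<phi>"
  obtains L where "L \<ge> 0" "\<And>c a b. \<bar>\<phi> (exp a * c) - \<phi> (exp b * c)\<bar> \<le> L * \<bar>a - b\<bar>"
proof -
  from assms obtain D where D: "\<And>t. D 0 t = \<phi> t" "\<And>n t. (D n has_real_derivative D (Suc n) t) (at t)"
    unfolding transition_function_def smooth_on_def has_real_derivative_iff_has_vector_derivative by auto
  have \<phi>: "\<phi> = D 0" using D(1) by auto
  have out: "D 1 t = 0" if "\<bar>t\<bar> > 1" for t
  proof -
    have "\<forall>\<^sub>F y in nhds t. \<phi> y = sgn t"
    proof (cases "t > 0")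
      case True
      then show ?thesis
        using assms that unfolding eventually_nhds transition_function_def
        by (intro exI[of _ "{1<..}"]) auto
    next
      case False
      then show ?thesis
        using assms that unfolding eventually_nhds transition_function_def
        by (intro exI[of _ "{..<-1}"]) auto
    qed
    then have "(\<phi> has_real_derivative 0) (at t)"
      by (subst DERIV_cong_ev[OF refl _ refl, where g = "\<lambda>_. sgn t"]) auto
    then show ?thesis using D(2)[of 0 t] DERIV_unique by (auto simp: \<phi>)
  qed
  have "continuous_on {-1..1} (\<lambda>t. D 1 t)"
    by (intro continuous_at_imp_continuous_on ballI DERIV_isCont[OF D(2)])
  then have "bounded ((\<lambda>t. D 1 t) ` {-1..1})"
    by (intro compact_imp_bounded compact_continuous_image) auto
  then obtain L where L: "L > 0" "\<And>t. t \<in> {-1..1} \<Longrightarrow> \<bar>D 1 t\<bar> \<le> L"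
    by (force simp: bounded_pos)
  have L': "\<bar>D 1 t * t\<bar> \<le> L" for t
  proof (cases "\<bar>t\<bar> \<le> 1")
    case True
    then have "\<bar>D 1 t * t\<bar> \<le> L * 1" unfolding abs_mult using L(1) L(2)[of t] by (intro mult_mono) (auto simp: abs_le_iff)
    then show ?thesis by simp
  qed (use out L in auto)
  have "\<bar>\<phi> (exp a * c) - \<phi> (exp b * c)\<bar> \<le> L * \<bar>a - b\<bar>" for a b c
  proof -
    have d: "((\<lambda>w. \<phi> (exp w * c)) has_real_derivative D 1 (exp w * c) * (exp w * c)) (at w)" for w
      unfolding \<phi> using D(2)[of 0]
      by (auto intro!: derivative_eq_intros DERIV_chain2[where f = "D 0"])
    have "norm (\<phi> (exp a * c) - \<phi> (exp b * c)) \<le> L * norm (a - b)"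
      by (rule field_differentiable_bound[of UNIV, OF convex_UNIV d]) (use L' in auto)
    then show ?thesis by simp
  qed
  with L(1) show thesis by (intro that[of L]) auto
qed

section \<open>Polynomials with prescribed circle means\<close>

definition circle_mean :: "real poly \<Rightarrow> real \<Rightarrow> real" where
  "circle_mean p r = integral {0..2*pi} (\<lambda>t. poly p (r * cos t))"

text \<open>
  \<open>x \<partial>/\<partial>x\<close>, the derivative with respect to the logarithmic coordinate \<open>ln x\<close>. It commutes with
  taking circle means, so the circle mean of \<open>euler_derivative p\<close> is \<open>r\<close> times the derivative of
  the circle mean of \<open>p\<close>.
\<close>

definition euler_derivative :: "real poly \<Rightarrow> real poly" where
  "euler_derivative p = [:0, 1:] * pderiv p"

lemma poly_cos_integrable: "(\<lambda>t. poly p (r * cos t)) integrable_on {0..2*pi}"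
  by (intro integrable_continuous_interval continuous_intros)

lemma circle_mean_add: "circle_mean (p + q) r = circle_mean p r + circle_mean q r"
  unfolding circle_mean_def by (simp add: integral_add poly_cos_integrable)

lemma circle_mean_sum: "circle_mean (\<Sum>j\<in>A. f j) r = (\<Sum>j\<in>A. circle_mean (f j) r)"
proof -
  have "circle_mean 0 r = 0" by (simp add: circle_mean_def)
  then show ?thesis
    by (induction A rule: infinite_finite_induct) (simp_all add: circle_mean_add)
qed

lemma circle_mean_monom:
  "circle_mean (monom c j) r = c * r ^ j * integral {0..2*pi} (\<lambda>t. cos t ^ j)"
  unfolding circle_mean_def
  by (simp add: poly_monom power_mult_distrib mult.assoc[symmetric])

lemma integral_cos_period: "integral {0..2*pi} cos = 0"
proof -
  have "(cos has_integral (sin (2*pi) - sin 0)) {0..2*pi}"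
    by (rule fundamental_theorem_of_calculus)
       (auto intro!: derivative_eq_intros simp flip: has_real_derivative_iff_has_vector_derivative)
  then show ?thesis by (simp add: integral_unique)
qed

lemma integral_cos_even_power_nonzero: "integral {0..2*pi} (\<lambda>t. cos t ^ (2 * j)) \<noteq> 0"
proof
  let ?f = "\<lambda>t::real. cos t ^ (2 * j)"
  assume "integral {0..2*pi} ?f = 0"
  moreover have cont: "continuous_on {0..2*pi} ?f" by (intro continuous_intros)
  ultimately have "(?f has_integral 0) (cbox 0 (2*pi))"
    using integrable_integral[OF integrable_continuous_interval[OF cont]] by simp
  then have "?f 0 = 0"
    by (rule has_integral_0_cbox_imp_0[rotated 2]) (use cont in \<open>auto simp: not_le\<close>)
  then show False by simp
qed

lemma pderiv_sum: "pderiv (\<Sum>j\<in>A. f j) = (\<Sum>j\<in>A. pderiv (f j))"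
  by (induction A rule: infinite_finite_induct) (simp_all add: pderiv_add)

lemma X_pderiv_monom: "[:0, 1:] * pderiv (monom c j) = monom (of_nat j * c :: real) j"
  by (cases j) (simp_all add: pderiv_monom flip: monom_Suc)

text \<open>
  Averaging over the circle multiplies \<open>x\<^sup>j\<close> by the number \<open>\<integral> cos\<^sup>j\<close>, which is nonzero for even
  \<open>j\<close>. So any polynomial \<open>q\<close> in \<open>r\<^sup>2\<close> is a circle mean, in particular the product of the factors
  \<open>r\<^sup>2 - R\<^sub>i\<^sup>2\<close>, with simple zeros exactly at the \<open>R\<^sub>i\<close>. A linear term has mean zero, and a large
  one makes \<open>p\<close> increasing on \<open>[-1, 1]\<close> without moving the zeros. The last property says that
  the zeros are simple.
\<close>

lemma circle_mean_simple_zeros: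
  fixes R :: "nat \<Rightarrow> real"
  assumes R: "\<And>i. i \<le> k \<Longrightarrow> R i > 0" "inj_on R {..k}"
  obtains p :: "real poly" where
    "\<And>x. \<bar>x\<bar> \<le> 1 \<Longrightarrow> poly (pderiv p) x > 0"
    "\<And>i. i \<le> k \<Longrightarrow> circle_mean p (R i) = 0"
    "\<And>i. i \<le> k \<Longrightarrow> circle_mean (euler_derivative p) (R i) \<noteq> 0"
proof -
  define q :: "real poly" where "q = (\<Prod>i\<le>k. [:- ((R i)\<^sup>2), 1:])"
  have q_zero: "poly q ((R i)\<^sup>2) = 0" and q_simple: "poly (pderiv q) ((R i)\<^sup>2) \<noteq> 0" if "i \<le> k" for i
  proof -
    let ?q = "\<Prod>j\<in>{..k} - {i}. [:- ((R j)\<^sup>2), 1:]"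
    have q: "q = [:- ((R i)\<^sup>2), 1:] * ?q"
      unfolding q_def using that by (intro prod.remove) auto
    then show "poly q ((R i)\<^sup>2) = 0" by simp
    have "(R i)\<^sup>2 \<noteq> (R j)\<^sup>2" if "j \<in> {..k} - {i}" for j
      using inj_onD[OF R(2), of i j] R(1)[of i] R(1)[of j] that \<open>i \<le> k\<close>
      by (auto simp: power2_eq_iff)
    then have "poly ?q ((R i)\<^sup>2) \<noteq> 0" by (simp add: poly_prod)
    moreover have "poly (pderiv q) ((R i)\<^sup>2) = poly ?q ((R i)\<^sup>2)"
      unfolding q by (subst pderiv_mult) (simp add: pderiv_pCons)
    ultimately show "poly (pderiv q) ((R i)\<^sup>2) \<noteq> 0" by simp
  qed
  let ?m = "\<lambda>j. integral {0..2*pi} (\<lambda>t. cos t ^ (2 * j))"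
  define e where "e = (\<Sum>j\<le>degree q. monom (coeff q j / ?m j) (2 * j))"
  have "compact ((\<lambda>x. poly (pderiv e) x) ` {-1..1})"
    by (intro compact_continuous_image continuous_intros) auto
  then obtain K where K: "\<And>x. x \<in> {-1..1} \<Longrightarrow> \<bar>poly (pderiv e) x\<bar> \<le> K"
    using compact_imp_bounded[of "(\<lambda>x. poly (pderiv e) x) ` {-1..1}"] by (force simp: bounded_iff)
  define p where "p = e + monom (K + 1) 1"
  have pd: "poly (pderiv p) x > 0" if "\<bar>x\<bar> \<le> 1" for x
  proof -
    have "\<bar>poly (pderiv e) x\<bar> \<le> K" using K[of x] that by (simp add: abs_le_iff)
    then show ?thesis by (simp add: p_def pderiv_add pderiv_monom poly_monom)
  qed
  have q_eq: "q = (\<Sum>j\<le>degree q. monom (coeff q j) j)"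
    by (rule poly_as_sum_of_monoms[symmetric])
  have mean_e: "circle_mean e r = poly q (r\<^sup>2)" for r
  proof -
    have "circle_mean e r = (\<Sum>j\<le>degree q. coeff q j * r ^ (2 * j))"
      unfolding e_def circle_mean_sum
      by (intro sum.cong refl) (simp add: circle_mean_monom integral_cos_even_power_nonzero)
    also have "\<dots> = poly q (r\<^sup>2)" by (simp add: poly_altdef power_mult)
    finally show ?thesis .
  qed
  have Xe: "[:0, 1:] * pderiv e = (\<Sum>j\<le>degree q. monom (of_nat (2 * j) * (coeff q j / ?m j)) (2 * j))"
    unfolding e_def pderiv_sum sum_distrib_left X_pderiv_monom ..
  have mean_Xe: "circle_mean ([:0, 1:] * pderiv e) r = 2 * r\<^sup>2 * poly (pderiv q) (r\<^sup>2)" for r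
  proof -
    have "circle_mean ([:0, 1:] * pderiv e) r
        = (\<Sum>j\<le>degree q. 2 * poly (monom (of_nat j * coeff q j) j) (r\<^sup>2))"
      unfolding Xe circle_mean_sum
      by (intro sum.cong refl)
         (simp add: circle_mean_monom integral_cos_even_power_nonzero poly_monom power_mult[of r])
    also have "\<dots> = 2 * poly (\<Sum>j\<le>degree q. [:0, 1:] * pderiv (monom (coeff q j) j)) (r\<^sup>2)"
      unfolding X_pderiv_monom poly_sum sum_distrib_left ..
    also have "(\<Sum>j\<le>degree q. [:0, 1:] * pderiv (monom (coeff q j) j)) = [:0, 1:] * pderiv q"
      unfolding sum_distrib_left[symmetric] pderiv_sum[symmetric] q_eq[symmetric] ..
    also have "2 * poly ([:0, 1:] * pderiv q) (r\<^sup>2) = 2 * r\<^sup>2 * poly (pderiv q) (r\<^sup>2)" by simp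
    finally show ?thesis .
  qed
  have odd: "circle_mean (monom c 1) r = 0" for c r
    using integral_cos_period by (simp only: circle_mean_monom power_one_right)
  have "circle_mean p (R i) = 0" if "i \<le> k" for i
    using q_zero[OF that] by (simp only: p_def circle_mean_add mean_e odd)
  moreover have "circle_mean ([:0, 1:] * pderiv p) (R i) \<noteq> 0" if "i \<le> k" for i
  proof -
    have "[:0, 1:] * pderiv p = [:0, 1:] * pderiv e + monom (K + 1) 1"
      unfolding p_def pderiv_add distrib_left X_pderiv_monom by simp
    then have "circle_mean ([:0, 1:] * pderiv p) (R i) = 2 * (R i)\<^sup>2 * poly (pderiv q) ((R i)\<^sup>2)"
      by (simp only: circle_mean_add mean_Xe odd)
    with q_simple[OF that] R(1)[OF that] show ?thesis by simp
  qed
  ultimately show thesis using pd that unfolding euler_derivative_def by blast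
qed

section \<open>Scalar differential equations\<close>

text \<open>
  Gronwall's inequality in both time directions: \<open>u\<^sup>2\<close> times \<open>exp (-2 L r)\<close> does not increase, and
  time reversal gives the other half. Since both directions are covered, a function that vanishes
  once vanishes identically.
\<close>

lemma linear_growth_bound:
  fixes u u' :: "real \<Rightarrow> real"
  assumes I: "is_interval I" and st: "s \<in> I" "t \<in> I"
    and u: "\<And>r. r \<in> I \<Longrightarrow> (u has_real_derivative u' r) (at r within I)"
    and le: "\<And>r. r \<in> I \<Longrightarrow> \<bar>u' r\<bar> \<le> L * \<bar>u r\<bar>"
  shows "\<bar>u t\<bar> \<le> \<bar>u s\<bar> * exp (L * \<bar>t - s\<bar>)"
proof -
  have forward: "\<bar>w b\<bar> \<le> \<bar>w a\<bar> * exp (L * (b - a))"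
    if ab: "a \<le> b" and w: "\<And>r. r \<in> {a..b} \<Longrightarrow> (w has_real_derivative w' r) (at r within {a..b})"
      and le: "\<And>r. r \<in> {a..b} \<Longrightarrow> \<bar>w' r\<bar> \<le> L * \<bar>w r\<bar>"
    for w w' :: "real \<Rightarrow> real" and a b
  proof -
    let ?v = "\<lambda>r. (w r)\<^sup>2 * exp (-2 * L * r)"
    let ?v' = "\<lambda>r. 2 * (w r * w' r - L * (w r)\<^sup>2) * exp (-2 * L * r)"
    have "(?v has_derivative (*) (?v' r)) (at r within {a..b})" if "a \<le> r" "r \<le> b" for r
      unfolding has_field_derivative_def[symmetric] using that
      by (auto intro!: derivative_eq_intros w simp: algebra_simps power2_eq_square)
    from mvt_very_simple[OF ab this] obtain r where r: "r \<in> {a..b}" "?v b - ?v a = ?v' r * (b - a)"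
      by auto
    have "w r * w' r \<le> \<bar>w r\<bar> * \<bar>w' r\<bar>" by (simp flip: abs_mult)
    also have "\<dots> \<le> \<bar>w r\<bar> * (L * \<bar>w r\<bar>)" by (intro mult_left_mono le r) auto
    also have "\<dots> = L * (w r)\<^sup>2" by (simp add: power2_eq_square)
    finally have "?v' r * (b - a) \<le> 0"
      using ab by (intro mult_nonpos_nonneg[of _ "b - a"] mult_nonpos_nonneg[of _ "exp _"]
          mult_nonneg_nonpos[of 2]) auto
    with r have "?v b \<le> ?v a" by linarith
    then have "?v b * exp (2 * L * b) \<le> ?v a * exp (2 * L * b)" by (rule mult_right_mono) simp
    then have "(w b)\<^sup>2 \<le> (w a)\<^sup>2 * exp (2 * L * (b - a))"
      by (simp add: mult.assoc right_diff_distrib flip: exp_add)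
    also have "\<dots> = (\<bar>w a\<bar> * exp (L * (b - a)))\<^sup>2"
      by (simp add: power_mult_distrib exp_double[symmetric] mult.assoc)
    finally have "\<bar>w b\<bar> \<le> \<bar>\<bar>w a\<bar> * exp (L * (b - a))\<bar>"
      by (simp only: abs_le_square_iff)
    then show ?thesis by (simp add: abs_mult)
  qed
  show ?thesis
  proof (cases "s \<le> t")
    case True
    have sub: "{s..t} \<subseteq> I"
      using I st unfolding is_interval_1 by (meson atLeastAtMost_iff subsetI)
    have "\<bar>u t\<bar> \<le> \<bar>u s\<bar> * exp (L * (t - s))"
      by (rule forward[OF True DERIV_subset[OF u sub] le]) (use sub in auto)
    with True show ?thesis by simp
  next
    case False
    have sub: "{t..s} \<subseteq> I"
      using I st unfolding is_interval_1 by (meson atLeastAtMost_iff subsetI)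
    have d: "((\<lambda>r. u (- r)) has_real_derivative - u' (- r)) (at r within {-s..-t})" if "r \<in> {-s..-t}" for r
    proof -
      have "(u has_real_derivative u' (- r)) (at (- r) within uminus ` {-s..-t})"
        by (rule DERIV_subset[OF u]) (use that sub in auto)
      moreover have "(uminus has_real_derivative -1) (at r within {-s..-t})"
        by (auto intro!: derivative_eq_intros)
      ultimately show ?thesis
        using DERIV_image_chain[of u "u' (- r)" uminus r "{-s..-t}" "-1"] by (simp add: o_def)
    qed
    have le': "\<bar>- u' (- r)\<bar> \<le> L * \<bar>u (- r)\<bar>" if "r \<in> {-s..-t}" for r
    proof -
      have "- r \<in> I" using that sub by auto
      from le[OF this] show ?thesis by simp
    qed
    have "\<bar>u (- (- t))\<bar> \<le> \<bar>u (- (- s))\<bar> * exp (L * (- t - (- s)))"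
      by (rule forward[where w = "\<lambda>r. u (- r)", OF _ d le']) (use False in auto)
    with False show ?thesis by simp
  qed
qed

text \<open>
  Picard iteration as a contraction of the bounded continuous functions on the line. Time is
  clamped to \<open>[-T, T]\<close> to keep the iterates bounded, and the solution is read off from the
  antiderivative instead of the clamped fixed point, so that it has a two-sided derivative at
  the end points as well.
\<close>

lemma scalar_ode_solution_exists:
  fixes f :: "real \<Rightarrow> real \<Rightarrow> real"
  assumes cont: "continuous_on UNIV (\<lambda>(t, w). f t w)"
    and lip: "\<And>t v w. \<bar>f t v - f t w\<bar> \<le> K * \<bar>v - w\<bar>"
    and T: "0 \<le> T" "K * T < 1" and K: "0 \<le> K"
  obtains S where "S 0 = a" "\<And>t. \<bar>t\<bar> \<le> T \<Longrightarrow> (S has_real_derivative f t (S t)) (at t)"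
proof -
  have "\<exists>G. (\<forall>t. (G has_real_derivative f t (apply_bcontfun S t)) (at t)) \<and> G 0 = 0"
    for S :: "real \<Rightarrow>\<^sub>C real"
  proof -
    have "continuous_on UNIV (\<lambda>t. f t (apply_bcontfun S t))"
      using continuous_on_compose2[OF cont, of UNIV "\<lambda>t. (t, apply_bcontfun S t)"]
      by (simp add: continuous_on_Pair)
    then obtain G where "\<And>t. (G has_real_derivative f t (apply_bcontfun S t)) (at t)"
      using has_antiderivative_real by (metis continuous_on_eq_continuous_at open_UNIV UNIV_I)
    then have "\<forall>t. ((\<lambda>t. G t - G 0) has_real_derivative f t (apply_bcontfun S t)) (at t)"
      by (auto intro!: derivative_eq_intros)
    then show ?thesis by (intro exI[of _ "\<lambda>t. G t - G 0"]) auto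
  qed
  then obtain G where G: "\<And>S t. (G S has_real_derivative f t (apply_bcontfun S t)) (at t)" "\<And>S. G S 0 = 0"
    by metis
  define cl where "cl t = max (-T) (min t T)" for t
  have cl: "\<bar>cl t\<bar> \<le> T" for t using T by (auto simp: cl_def)
  define \<Phi> where "\<Phi> S = Bcontfun (\<lambda>t. a + G S (cl t))" for S
  have \<Phi>: "apply_bcontfun (\<Phi> S) t = a + G S (cl t)" for S t
  proof -
    have contG: "continuous_on A (G S)" for A
      by (intro continuous_at_imp_continuous_on ballI DERIV_isCont[OF G(1)])
    have "bounded (G S ` {-T..T})"
      by (intro compact_imp_bounded compact_continuous_image contG) auto
    then obtain B where B: "\<And>r. \<bar>r\<bar> \<le> T \<Longrightarrow> \<bar>G S r\<bar> \<le> B"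
      by (force simp: bounded_iff abs_le_iff)
    have "(\<lambda>t. a + G S (cl t)) \<in> bcontfun"
    proof (rule bcontfun_normI)
      show "continuous_on UNIV (\<lambda>t. a + G S (cl t))"
        unfolding cl_def by (intro continuous_intros continuous_on_compose2[OF contG[of UNIV]]) auto
      show "norm (a + G S (cl t)) \<le> \<bar>a\<bar> + B" for t using B[OF cl[of t]] by simp
    qed
    then show ?thesis by (simp add: \<Phi>_def Bcontfun_inverse)
  qed
  have "dist (\<Phi> S) (\<Phi> V) \<le> K * T * dist S V" for S V
  proof (rule dist_bound)
    fix t
    have "norm ((G S (cl t) - G V (cl t)) - (G S 0 - G V 0)) \<le> K * dist S V * norm (cl t - 0)"
    proof (rule field_differentiable_bound[of UNIV "\<lambda>r. G S r - G V r"])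
      fix r
      show "((\<lambda>r. G S r - G V r) has_real_derivative f r (apply_bcontfun S r) - f r (apply_bcontfun V r)) (at r within UNIV)"
        by (intro DERIV_diff G(1))
      have "norm (f r (apply_bcontfun S r) - f r (apply_bcontfun V r)) \<le> K * dist (apply_bcontfun S r) (apply_bcontfun V r)"
        using lip by (simp add: dist_real_def)
      also have "\<dots> \<le> K * dist S V" by (intro mult_left_mono dist_bounded K)
      finally show "norm (f r (apply_bcontfun S r) - f r (apply_bcontfun V r)) \<le> K * dist S V" .
    qed auto
    also have "\<dots> \<le> K * dist S V * T" using cl K by (intro mult_left_mono) auto
    finally show "dist (apply_bcontfun (\<Phi> S) t) (apply_bcontfun (\<Phi> V) t) \<le> K * T * dist S V"
      by (simp add: \<Phi> G(2) dist_real_def mult_ac)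
  qed
  then obtain S where S: "\<Phi> S = S"
    using banach_fix_type[of "K * T" \<Phi>] T K by auto
  show thesis
  proof (rule that[of "\<lambda>t. a + G S t"])
    fix t assume "\<bar>t\<bar> \<le> T"
    then have "cl t = t" by (auto simp: cl_def)
    then have "apply_bcontfun S t = a + G S t" using \<Phi>[of S t] by (simp add: S)
    then show "((\<lambda>t. a + G S t) has_real_derivative f t (a + G S t)) (at t)"
      using G(1)[of S t] by (auto intro!: derivative_eq_intros)
  qed (simp add: G(2))
qed

section \<open>The angular equation\<close>

text \<open>
  The equation \<open>W' = \<phi> (e\<^sup>W cos t)\<close> for the logarithm \<open>W\<close> of the radius, in units of \<open>\<epsilon>\<close>, as a
  function of the polar angle \<open>t\<close>.
\<close>

definition angular_solution :: "(real \<Rightarrow> real) \<Rightarrow> (real \<Rightarrow> real) \<Rightarrow> real set \<Rightarrow> bool" where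
  "angular_solution \<phi> W I \<longleftrightarrow>
     (\<forall>t\<in>I. (W has_real_derivative \<phi> (exp (W t) * cos t)) (at t within I))"

lemma DERIV_poly_exp:
  "((\<lambda>w. poly p (exp w * c)) has_real_derivative poly (euler_derivative p) (exp w * c)) (at w)"
  by (auto intro!: derivative_eq_intros simp: euler_derivative_def)

lemma poly_exp_diff:
  obtains \<xi> where "\<xi> \<in> closed_segment v w"
    "poly p (exp v * c) - poly p (exp w * c) = (v - w) * poly (euler_derivative p) (exp \<xi> * c)"
proof -
  have *: "\<exists>\<xi>\<in>{a..b}. poly p (exp b * c) - poly p (exp a * c)
             = (b - a) * poly (euler_derivative p) (exp \<xi> * c)" if "a < b" for a b
    using MVT2[OF that DERIV_poly_exp[of p c]] by fastforce
  consider "v < w" | "w < v" | "v = w" by linarith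
  then have "\<exists>\<xi>\<in>closed_segment v w. poly p (exp v * c) - poly p (exp w * c)
               = (v - w) * poly (euler_derivative p) (exp \<xi> * c)"
  proof cases
    case 1
    from *[OF 1] obtain \<xi> where \<xi>: "\<xi> \<in> {v..w}" "poly p (exp w * c) - poly p (exp v * c)
        = (w - v) * poly (euler_derivative p) (exp \<xi> * c)" by blast
    then show ?thesis
      using 1 by (intro bexI[of _ \<xi>]) (auto simp: closed_segment_eq_real_ivl algebra_simps)
  next
    case 2
    with *[OF 2] show ?thesis by (auto simp: closed_segment_eq_real_ivl)
  qed auto
  with that show thesis by blast
qed

lemma poly_exp_Lipschitz:
  assumes C: "\<And>x. \<bar>x\<bar> \<le> 1 \<Longrightarrow> \<bar>poly (euler_derivative p) x\<bar> \<le> C"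
    and vw: "v \<le> 0" "w \<le> 0" and c: "\<bar>c\<bar> \<le> 1"
  shows "\<bar>poly p (exp v * c) - poly p (exp w * c)\<bar> \<le> C * \<bar>v - w\<bar>"
proof -
  obtain \<xi> where \<xi>: "\<xi> \<in> closed_segment v w"
    "poly p (exp v * c) - poly p (exp w * c) = (v - w) * poly (euler_derivative p) (exp \<xi> * c)"
    by (rule poly_exp_diff)
  have "\<xi> \<le> 0" using \<xi>(1) vw by (auto simp: closed_segment_eq_real_ivl split: if_splits)
  then have "\<bar>exp \<xi> * c\<bar> \<le> 1 * 1" unfolding abs_mult using c by (intro mult_mono) auto
  then have "\<bar>poly (euler_derivative p) (exp \<xi> * c)\<bar> \<le> C" using C by simp
  then show ?thesis
    unfolding \<xi>(2) abs_mult by (subst mult.commute) (intro mult_right_mono, auto)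
qed

lemma abs_exp_cos_le_half:
  fixes w t :: real
  assumes "w \<le> -1"
  shows "\<bar>exp w * cos t\<bar> \<le> 1/2"
proof -
  have "exp w \<le> exp (-1)" using assms by simp
  also have "exp (-1) = 1 / exp (1::real)" by (simp add: exp_minus field_simps)
  also have "\<dots> \<le> 1/2" using exp_ge_add_one_self[of 1] by (simp add: field_simps)
  finally have "\<bar>exp w\<bar> * \<bar>cos t\<bar> \<le> 1/2 * 1" by (intro mult_mono) auto
  then show ?thesis by (simp add: abs_mult)
qed

lemma angular_solution_continuous_on:
  "angular_solution \<phi> W I \<Longrightarrow> continuous_on I W"
  unfolding angular_solution_def by (rule DERIV_continuous_on) blast

lemma angular_solution_subset:
  "angular_solution \<phi> W J \<Longrightarrow> I \<subseteq> J \<Longrightarrow> angular_solution \<phi> W I"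
  unfolding angular_solution_def by (meson DERIV_subset subsetD)

lemma angular_solutions_difference:
  assumes W: "angular_solution \<phi> W {0..2*pi}" and V: "angular_solution \<phi> V {0..2*pi}"
    and small: "\<And>t. t \<in> {0..2*pi} \<Longrightarrow> W t \<le> -1 \<and> V t \<le> -1"
    and inner: "\<And>x. \<bar>x\<bar> \<le> 1/2 \<Longrightarrow> \<phi> x = \<delta> * poly p x" and "\<delta> \<ge> 0"
    and C: "\<And>x. \<bar>x\<bar> \<le> 1 \<Longrightarrow> \<bar>poly (euler_derivative p) x\<bar> \<le> C"
  shows "\<And>t. t \<in> {0..2*pi} \<Longrightarrow> ((\<lambda>t. W t - V t) has_real_derivative
            \<delta> * (poly p (exp (W t) * cos t) - poly p (exp (V t) * cos t))) (at t within {0..2*pi})"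
    and "\<And>s t. s \<in> {0..2*pi} \<Longrightarrow> t \<in> {0..2*pi} \<Longrightarrow>
           \<bar>W s - V s\<bar> \<le> \<bar>W t - V t\<bar> * exp (\<delta> * C * \<bar>s - t\<bar>)"
proof -
  define u where "u t = W t - V t" for t
  have du: "(u has_real_derivative \<delta> * (poly p (exp (W t) * cos t) - poly p (exp (V t) * cos t))) (at t within {0..2*pi})"
    if "t \<in> {0..2*pi}" for t
  proof -
    have "(u has_real_derivative \<phi> (exp (W t) * cos t) - \<phi> (exp (V t) * cos t)) (at t within {0..2*pi})"
      unfolding u_def using W V that unfolding angular_solution_def by (intro DERIV_diff) auto
    then show ?thesis
      using small[OF that] inner[OF abs_exp_cos_le_half[of "W t" t]] inner[OF abs_exp_cos_le_half[of "V t" t]]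
      by (simp add: right_diff_distrib)
  qed
  have growth: "\<bar>u s\<bar> \<le> \<bar>u t\<bar> * exp (\<delta> * C * \<bar>s - t\<bar>)" if st: "s \<in> {0..2*pi}" "t \<in> {0..2*pi}" for s t
  proof (rule linear_growth_bound[OF _ st(2,1) du])
    fix r assume r: "r \<in> {0..2*pi}"
    have "\<bar>poly p (exp (W r) * cos r) - poly p (exp (V r) * cos r)\<bar> \<le> C * \<bar>u r\<bar>"
      unfolding u_def using small[OF r] by (intro poly_exp_Lipschitz C) auto
    then have "\<delta> * \<bar>poly p (exp (W r) * cos r) - poly p (exp (V r) * cos r)\<bar> \<le> \<delta> * (C * \<bar>u r\<bar>)"
      using \<open>\<delta> \<ge> 0\<close> by (rule mult_left_mono)
    then show "\<bar>\<delta> * (poly p (exp (W r) * cos r) - poly p (exp (V r) * cos r))\<bar> \<le> \<delta> * C * \<bar>u r\<bar>"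
      using \<open>\<delta> \<ge> 0\<close> by (simp add: abs_mult mult.assoc)
  qed auto
  show "((\<lambda>t. W t - V t) has_real_derivative
            \<delta> * (poly p (exp (W t) * cos t) - poly p (exp (V t) * cos t))) (at t within {0..2*pi})"
    if "t \<in> {0..2*pi}" for t using du[OF that] by (simp add: u_def[abs_def])
  show "\<bar>W s - V s\<bar> \<le> \<bar>W t - V t\<bar> * exp (\<delta> * C * \<bar>s - t\<bar>)"
    if "s \<in> {0..2*pi}" "t \<in> {0..2*pi}" for s t using growth[OF that] by (simp add: u_def)
qed

text \<open>
  The difference \<open>u\<close> of two solutions satisfies the linear equation \<open>u' = \<delta> q u\<close> with the
  difference quotient \<open>q\<close> of \<open>w \<mapsto> p (e\<^sup>w cos t)\<close>, and is therefore multiplied over one period by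
  \<open>exp (\<delta> \<integral> q)\<close>. By the mean value theorem \<open>q\<close> is a value of the \<open>w\<close>-derivative between the two
  solutions, hence close to any \<open>m\<close> that is close to this derivative there. With \<open>m\<close> taken
  along a circle this gives uniqueness of fixed points of the period map; with \<open>m\<close> taken along
  one of the solutions it gives the derivative of the period map.
\<close>

lemma period_ratio:
  assumes W: "angular_solution \<phi> W {0..2*pi}" and V: "angular_solution \<phi> V {0..2*pi}"
    and small: "\<And>t. t \<in> {0..2*pi} \<Longrightarrow> W t \<le> -1 \<and> V t \<le> -1"
    and inner: "\<And>x. \<bar>x\<bar> \<le> 1/2 \<Longrightarrow> \<phi> x = \<delta> * poly p x" and "\<delta> \<ge> 0"
    and C: "\<And>x. \<bar>x\<bar> \<le> 1 \<Longrightarrow> \<bar>poly (euler_derivative p) x\<bar> \<le> C"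
    and m: "continuous_on {0..2*pi} m"
    and close: "\<And>t \<xi>. t \<in> {0..2*pi} \<Longrightarrow> \<xi> \<in> closed_segment (W t) (V t) \<Longrightarrow>
           \<bar>poly (euler_derivative p) (exp \<xi> * cos t) - m t\<bar> \<le> \<eta>"
    and neq: "W 0 \<noteq> V 0"
  shows "\<exists>I. W (2*pi) - V (2*pi) = (W 0 - V 0) * exp (\<delta> * I) \<and>
             \<bar>I - integral {0..2*pi} m\<bar> \<le> \<eta> * (2 * pi)"
proof -
  define u where "u t = W t - V t" for t
  define q where "q t = (poly p (exp (W t) * cos t) - poly p (exp (V t) * cos t)) / u t" for t
  note diff = angular_solutions_difference[OF W V small inner \<open>\<delta> \<ge> 0\<close> C]
  have difference: "(u has_real_derivative
        \<delta> * (poly p (exp (W t) * cos t) - poly p (exp (V t) * cos t))) (at t within {0..2*pi})"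
    "\<bar>u s\<bar> \<le> \<bar>u t\<bar> * exp (\<delta> * C * \<bar>s - t\<bar>)"
    if "s \<in> {0..2*pi}" "t \<in> {0..2*pi}" for s t
    unfolding u_def[abs_def] using diff(1)[of t] diff(2)[of s t] that by simp_all
  have u_nz: "u t \<noteq> 0" if "t \<in> {0..2*pi}" for t
    using difference(2)[of 0 t] that neq by (auto simp: u_def)
  have cont: "continuous_on {0..2*pi} W" "continuous_on {0..2*pi} V"
    using W V by (auto intro: angular_solution_continuous_on)
  have cont_q: "continuous_on {0..2*pi} q"
    unfolding q_def using u_nz unfolding u_def by (intro continuous_intros cont) auto
  have du': "(u has_real_derivative \<delta> * q t * u t) (at t within {0..2*pi})" if "t \<in> {0..2*pi}" for t
    using difference(1)[OF that that] u_nz[OF that] by (simp add: q_def u_def[abs_def])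
  \<comment> \<open>the solution formula for \<open>u\<close>: this product is constant\<close>
  define v where "v t = u t * exp (- \<delta> * integral {0..t} q)" for t
  have "(v has_real_derivative 0) (at t within {0..2*pi})" if "t \<in> {0..2*pi}" for t
    unfolding v_def
    by (rule derivative_eq_intros du'[OF that] integral_has_real_derivative[OF cont_q that] refl)+ simp
  then have "v (2*pi) = v 0"
    using has_field_derivative_zero_constant[of "{0..2*pi}" v] by force
  then have "u (2*pi) * exp (- \<delta> * integral {0..2*pi} q) * exp (\<delta> * integral {0..2*pi} q)
      = u 0 * exp (\<delta> * integral {0..2*pi} q)"
    by (simp add: v_def)
  then have "u (2*pi) = u 0 * exp (\<delta> * integral {0..2*pi} q)"
    by (simp add: mult.assoc flip: exp_add)
  moreover have "\<bar>integral {0..2*pi} q - integral {0..2*pi} m\<bar> \<le> \<eta> * (2 * pi)"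
  proof -
    have "norm (integral {0..2*pi} (\<lambda>t. q t - m t)) \<le> \<eta> * (2 * pi - 0)"
    proof (rule integral_bound)
      show "continuous_on {0..2*pi} (\<lambda>t. q t - m t)" by (intro continuous_intros cont_q m)
      fix t assume t: "t \<in> {0..2*pi}"
      obtain \<xi> where \<xi>: "\<xi> \<in> closed_segment (W t) (V t)"
        "poly p (exp (W t) * cos t) - poly p (exp (V t) * cos t)
           = (W t - V t) * poly (euler_derivative p) (exp \<xi> * cos t)"
        by (rule poly_exp_diff)
      with u_nz[OF t] have "q t = poly (euler_derivative p) (exp \<xi> * cos t)"
        by (simp add: q_def u_def)
      with close[OF t \<xi>(1)] show "norm (q t - m t) \<le> \<eta>" by simp
    qed simp
    then show ?thesis
      by (simp add: integral_diff integrable_continuous_interval cont_q m)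
  qed
  ultimately show ?thesis by (auto simp: u_def)
qed

section \<open>Averaging\<close>

text \<open>
  A priori only \<open>\<bar>W'\<bar> \<le> 1\<close> is known, so over one period \<open>2\<pi> < 8\<close> a solution that is somewhere below
  \<open>-9\<close> stays below \<open>-1\<close>. There \<open>e\<^sup>W \<le> 1/2\<close>, which puts it in the region where \<open>\<phi>\<close> is the small
  polynomial \<open>\<delta> p\<close>; then it hardly moves at all.
\<close>

lemma angular_solution_variation:
  assumes W: "angular_solution \<phi> W {0..2*pi}" and st: "s \<in> {0..2*pi}" "t \<in> {0..2*pi}"
    and le1: "\<And>x. \<bar>\<phi> x\<bar> \<le> 1" and Wt: "W t \<le> -9"
    and inner: "\<And>x. \<bar>x\<bar> \<le> 1/2 \<Longrightarrow> \<phi> x = \<delta> * poly p x" and "\<delta> \<ge> 0"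
    and C: "\<And>x. \<bar>x\<bar> \<le> 1 \<Longrightarrow> \<bar>poly p x\<bar> \<le> C" 
  shows "W s \<le> -1" and "\<bar>W s - W t\<bar> \<le> 8 * \<delta> * C"
proof -
  have d: "(W has_real_derivative \<phi> (exp (W r) * cos r)) (at r within {0..2*pi})" if "r \<in> {0..2*pi}" for r
    using W that by (simp add: angular_solution_def)
  have le: "W r \<le> -1" if r: "r \<in> {0..2*pi}" for r
  proof -
    have "norm (W r - W t) \<le> 1 * norm (r - t)"
      by (rule field_differentiable_bound[OF _ d]) (use st r le1 in auto)
    moreover have "\<bar>r - t\<bar> \<le> 8" using st r pi_less_4 by auto
    ultimately show ?thesis using Wt by simp
  qed
  then show "W s \<le> -1" using st by simp
  have C0: "C \<ge> 0" using C[of 0] by simp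
  have "norm (W s - W t) \<le> (\<delta> * C) * norm (s - t)"
  proof (rule field_differentiable_bound[OF _ d])
    fix r assume r: "r \<in> {0..2*pi}"
    have "\<bar>exp (W r) * cos r\<bar> \<le> 1/2" by (rule abs_exp_cos_le_half[OF le[OF r]])
    with C[of "exp (W r) * cos r"] inner \<open>\<delta> \<ge> 0\<close>
    show "norm (\<phi> (exp (W r) * cos r)) \<le> \<delta> * C"
      by (auto simp: abs_mult intro: mult_left_mono)
  qed (use st in auto)
  also have "\<dots> \<le> (\<delta> * C) * 8"
    using st pi_less_4 \<open>\<delta> \<ge> 0\<close> C0 by (intro mult_left_mono) auto
  finally show "\<bar>W s - W t\<bar> \<le> 8 * \<delta> * C" by simp
qed

text \<open>
  Replacing \<open>w\<close> by \<open>min w (-1)\<close> in \<open>\<delta> p (e\<^sup>w cos t)\<close> makes the right hand side globally Lipschitz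
  with a small constant. The solution of the truncated equation moves by less than \<open>1\<close>, so it
  never notices the truncation. The time interval exceeds one period on both sides, which the
  gluing of periodic solutions needs.
\<close>

lemma angular_solution_exists:
  assumes a: "a \<le> -9" and inner: "\<And>x. \<bar>x\<bar> \<le> 1/2 \<Longrightarrow> \<phi> x = \<delta> * poly p x" and "\<delta> \<ge> 0"
    and C: "\<And>x. \<bar>x\<bar> \<le> 1 \<Longrightarrow> \<bar>poly p x\<bar> \<le> C"
           "\<And>x. \<bar>x\<bar> \<le> 1 \<Longrightarrow> \<bar>poly (euler_derivative p) x\<bar> \<le> C"
    and small: "\<delta> * C * 10 < 1"
  shows "\<exists>S. S 0 = a \<and> angular_solution \<phi> S {-10<..<10}"
proof -
  have C0: "C \<ge> 0" using C(1)[of 0] by simp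
  define f where "f t w = \<delta> * poly p (exp (min w (-1)) * cos t)" for t w
  have "continuous_on UNIV (\<lambda>(t, w). f t w)"
    unfolding f_def case_prod_unfold by (intro continuous_intros)
  moreover have "\<bar>f t v - f t w\<bar> \<le> \<delta> * C * \<bar>v - w\<bar>" for t v w
  proof -
    have "\<bar>poly p (exp (min v (-1)) * cos t) - poly p (exp (min w (-1)) * cos t)\<bar> \<le> C * \<bar>min v (-1) - min w (-1)\<bar>"
      by (intro poly_exp_Lipschitz C(2)) auto
    also have "\<dots> \<le> C * \<bar>v - w\<bar>" using C0 by (intro mult_left_mono) (auto simp: min_def)
    finally show ?thesis
      using \<open>\<delta> \<ge> 0\<close> by (simp add: f_def abs_mult mult_left_mono mult.assoc flip: right_diff_distrib)
  qed
  moreover have "0 \<le> (10::real)" "0 \<le> \<delta> * C" using \<open>\<delta> \<ge> 0\<close> C0 by auto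
  ultimately obtain S where S: "S 0 = a" "\<And>t. \<bar>t\<bar> \<le> 10 \<Longrightarrow> (S has_real_derivative f t (S t)) (at t)"
    using scalar_ode_solution_exists[of f "\<delta> * C" 10 a] small by blast
  have f_le: "\<bar>f t w\<bar> \<le> \<delta> * C" for t w
  proof -
    have "\<bar>exp (min w (-1)) * cos t\<bar> \<le> 1/2" by (rule abs_exp_cos_le_half) simp
    with C(1)[of "exp (min w (-1)) * cos t"] \<open>\<delta> \<ge> 0\<close> show ?thesis
      by (auto simp: f_def abs_mult intro: mult_left_mono)
  qed
  have S_le: "S t \<le> -1" if t: "t \<in> {-10..10}" for t
  proof -
    have "norm (S t - S 0) \<le> (\<delta> * C) * norm (t - 0)"
      by (rule field_differentiable_bound[of "{-10..10}" S "\<lambda>t. f t (S t)"])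
         (use t S(2) f_le in \<open>auto intro: has_field_derivative_at_within\<close>)
    also have "\<dots> \<le> (\<delta> * C) * 10" using t \<open>\<delta> \<ge> 0\<close> C0 by (intro mult_left_mono) auto
    finally show ?thesis using small a S(1) by simp
  qed
  have "(S has_real_derivative \<phi> (exp (S t) * cos t)) (at t)" if t: "t \<in> {-10<..<10}" for t
  proof -
    have "f t (S t) = \<phi> (exp (S t) * cos t)"
      using S_le[of t] t inner[OF abs_exp_cos_le_half[of "S t" t]] by (simp add: f_def)
    with S(2)[of t] t show ?thesis by (simp add: abs_le_iff)
  qed
  with S(1) show ?thesis
    unfolding angular_solution_def
    by (intro exI[of _ S]) (auto intro: has_field_derivative_at_within)
qed

text \<open>
  What the planar argument needs to know about the angular equation near \<open>w0\<close>: solutions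
  that come close to \<open>w0\<close> hardly vary over a period; the solutions \<open>S a\<close> starting at \<open>a\<close> have a
  period map with a fixed point \<open>b\<close> and derivative \<open>d \<noteq> 1\<close> there; and \<open>b\<close> is the only initial
  value near \<open>w0\<close> of a solution that returns after one period. The margins \<open>\<kappa>/8\<close> and \<open>\<kappa>/2\<close> keep
  the whole periodic solution within \<open>3\<kappa>/4\<close> of \<open>w0\<close>, and still leave room to go once around
  from there without leaving the \<open>\<kappa>\<close>-neighbourhood.
\<close>

definition hyperbolic_angular_cycle :: "(real \<Rightarrow> real) \<Rightarrow> real \<Rightarrow> real \<Rightarrow> bool" where
  "hyperbolic_angular_cycle \<phi> w0 \<kappa> \<longleftrightarrow>
     (\<forall>W s t. angular_solution \<phi> W {0..2*pi} \<longrightarrow> s \<in> {0..2*pi} \<longrightarrow> t \<in> {0..2*pi} \<longrightarrow>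
        \<bar>W t - w0\<bar> \<le> 1 \<longrightarrow> \<bar>W s - W t\<bar> \<le> \<kappa> / 8) \<and>
     (\<exists>S b d.
        (\<forall>a. \<bar>a - w0\<bar> < \<kappa> \<longrightarrow> S a 0 = a \<and> angular_solution \<phi> (S a) {-10<..<10}) \<and>
        \<bar>b - w0\<bar> \<le> \<kappa> / 2 \<and> S b (2*pi) = b \<and>
        ((\<lambda>a. S a (2*pi)) has_real_derivative d) (at b) \<and> d \<noteq> 1 \<and>
        (\<forall>W. angular_solution \<phi> W {0..2*pi} \<longrightarrow> \<bar>W 0 - w0\<bar> < \<kappa> \<longrightarrow> W (2*pi) = W 0 \<longrightarrow> W 0 = b))"

lemma poly_bounded_on_unit:
  fixes p :: "real poly"
  obtains C where "\<And>x. \<bar>x\<bar> \<le> 1 \<Longrightarrow> \<bar>poly p x\<bar> \<le> C"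
proof -
  have "bounded (poly p ` {-1..1})"
    by (intro compact_imp_bounded compact_continuous_image continuous_intros) auto
  then show thesis using that by (force simp: bounded_iff abs_le_iff)
qed

text \<open>
  First order averaging. Up to errors of order \<open>\<delta>\<^sup>2\<close> the displacement \<open>S a (2\<pi>) - a\<close> is \<open>\<delta>\<close> times the
  circle mean of \<open>p\<close> at radius \<open>e\<^sup>a\<close>, which changes sign at \<open>w0\<close> with slope \<open>G \<noteq> 0\<close>; the intermediate
  value theorem yields a fixed point \<open>b\<close>. By \<open>period_ratio\<close> the period map multiplies distances
  near \<open>w0\<close> by \<open>exp (\<delta> I)\<close> with \<open>I\<close> close to \<open>G\<close>, hence never by \<open>1\<close>; this gives uniqueness and
  hyperbolicity at once.
\<close>

lemma averaged_cycle:
  assumes w0: "w0 \<le> -10" and zero: "circle_mean p (exp w0) = 0"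
    and simple: "circle_mean (euler_derivative p) (exp w0) \<noteq> 0"
  obtains \<kappa> \<delta>1 where "0 < \<kappa>" "\<kappa> \<le> 1/4" "0 < \<delta>1"
    "\<And>\<delta> \<phi>. 0 < \<delta> \<Longrightarrow> \<delta> \<le> \<delta>1 \<Longrightarrow> (\<And>x. \<bar>\<phi> x\<bar> \<le> 1) \<Longrightarrow>
       (\<And>x. \<bar>x\<bar> \<le> 1/2 \<Longrightarrow> \<phi> x = \<delta> * poly p x) \<Longrightarrow> hyperbolic_angular_cycle \<phi> w0 \<kappa>"
proof -
  let ?E = euler_derivative
  obtain C0 C1 C2 where C012:
    "\<And>x. \<bar>x\<bar> \<le> 1 \<Longrightarrow> \<bar>poly p x\<bar> \<le> C0"
    "\<And>x. \<bar>x\<bar> \<le> 1 \<Longrightarrow> \<bar>poly (?E p) x\<bar> \<le> C1"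
    "\<And>x. \<bar>x\<bar> \<le> 1 \<Longrightarrow> \<bar>poly (?E (?E p)) x\<bar> \<le> C2"
    using poly_bounded_on_unit by metis
  define C where "C = max 1 (max C0 (max C1 C2))"
  have "C \<ge> 1" by (simp add: C_def)
  have C: "\<And>x. \<bar>x\<bar> \<le> 1 \<Longrightarrow> \<bar>poly p x\<bar> \<le> C"
    "\<And>x. \<bar>x\<bar> \<le> 1 \<Longrightarrow> \<bar>poly (?E p) x\<bar> \<le> C"
    "\<And>x. \<bar>x\<bar> \<le> 1 \<Longrightarrow> \<bar>poly (?E (?E p)) x\<bar> \<le> C"
    using C012 unfolding C_def by (meson le_max_iff_disj)+
  define G where "G = circle_mean (?E p) (exp w0)"
  define c where "c = \<bar>G\<bar>"
  have "c > 0" using simple by (simp add: c_def G_def)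
  \<comment> \<open>within \<open>2\<kappa>\<close> of \<open>w0\<close> the period integral of the \<open>w\<close>-derivative differs from \<open>G\<close> by at
    most \<open>c/4\<close>; with \<open>\<delta> \<le> \<delta>1\<close> solutions vary by at most \<open>\<kappa>/8\<close> over a period, and the error of
    the averaged displacement stays below half of its main term \<open>\<kappa> c / 2\<close>\<close>
  define \<kappa> where "\<kappa> = min (1/4) (c / (64 * C))"
  define \<delta>1 where "\<delta>1 = min (\<kappa> / (64 * C)) (\<kappa> * c / (1024 * C\<^sup>2))"
  have \<kappa>: "0 < \<kappa>" "\<kappa> \<le> 1/4" using \<open>c > 0\<close> \<open>C \<ge> 1\<close> by (auto simp: \<kappa>_def)
  have "\<kappa> \<le> c / (64 * C)" by (simp add: \<kappa>_def)
  then have C\<kappa>: "16 * (C * \<kappa>) \<le> c / 4" using \<open>C \<ge> 1\<close> by (simp add: field_simps)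
  have "\<delta>1 > 0" using \<kappa> \<open>c > 0\<close> \<open>C \<ge> 1\<close> by (simp add: \<delta>1_def)
  moreover have "hyperbolic_angular_cycle \<phi> w0 \<kappa>"
    if \<delta>: "0 < \<delta>" "\<delta> \<le> \<delta>1" and le1: "\<And>x. \<bar>\<phi> x\<bar> \<le> 1"
      and inner: "\<And>x. \<bar>x\<bar> \<le> 1/2 \<Longrightarrow> \<phi> x = \<delta> * poly p x" for \<delta> \<phi>
  proof -
    have "\<delta> \<le> \<kappa> / (64 * C)" "\<delta> \<le> \<kappa> * c / (1024 * C\<^sup>2)" using \<delta> by (auto simp: \<delta>1_def)
    then have \<delta>C: "8 * \<delta> * C \<le> \<kappa> / 8" and \<delta>CC: "64 * (\<delta> * C * C) \<le> \<kappa> * c / 16"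
      using \<open>C \<ge> 1\<close> by (simp_all add: field_simps power2_eq_square)
    note \<delta>0 = less_imp_le[OF \<delta>(1)]
    have var: "W s \<le> -1" "\<bar>W s - W t\<bar> \<le> 8 * \<delta> * C"
      if "angular_solution \<phi> W {0..2*pi}" "s \<in> {0..2*pi}" "t \<in> {0..2*pi}" "W t \<le> -9" for W s t
      using angular_solution_variation[OF that(1-3) le1 that(4) inner \<delta>0 C(1)] by auto
    have near: "\<bar>W t - w0\<bar> \<le> 2 * \<kappa>" "W t \<le> -1"
      if W: "angular_solution \<phi> W {0..2*pi}" "\<bar>W 0 - w0\<bar> \<le> \<kappa>" and t: "t \<in> {0..2*pi}" for W t
    proof -
      have "W 0 \<le> -9" using W(2) w0 \<kappa> by simp
      with var[OF W(1) t, of 0] \<delta>C W(2) \<kappa> show "\<bar>W t - w0\<bar> \<le> 2 * \<kappa>" "W t \<le> -1" by auto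
    qed
    have Lip: "\<bar>poly (?E p) (exp v * cos t) - poly (?E p) (exp w * cos t)\<bar> \<le> C * \<bar>v - w\<bar>"
      if "v \<le> 0" "w \<le> 0" for v w t :: real
      using that by (intro poly_exp_Lipschitz C(3)) auto
    have Lip0: "\<bar>poly (?E p) (exp v * cos t) - poly (?E p) (exp w0 * cos t)\<bar> \<le> C * (2 * \<kappa>)"
      if "\<bar>v - w0\<bar> \<le> 2 * \<kappa>" for v t
    proof -
      have "\<bar>poly (?E p) (exp v * cos t) - poly (?E p) (exp w0 * cos t)\<bar> \<le> C * \<bar>v - w0\<bar>"
        using that w0 \<kappa> by (intro Lip) auto
      also have "\<dots> \<le> C * (2 * \<kappa>)" using that \<open>C \<ge> 1\<close> by (intro mult_left_mono) auto
      finally show ?thesis .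
    qed
    have scale_pi: "\<eta> * (2 * pi) \<le> 8 * \<eta>" if "\<eta> \<ge> 0" for \<eta>
      using mult_left_mono[OF less_imp_le[OF pi_less_4] that] by (simp add: mult.commute)
    have "C * (2 * \<kappa>) * (2 * pi) \<le> 8 * (C * (2 * \<kappa>))"
      using \<open>C \<ge> 1\<close> \<kappa> by (intro scale_pi) auto
    also have "\<dots> \<le> c / 4" using C\<kappa> by simp
    finally have C\<kappa>_pi: "C * (2 * \<kappa>) * (2 * pi) \<le> c / 4" .
    have ratio: "\<exists>I. W (2*pi) - V (2*pi) = (W 0 - V 0) * exp (\<delta> * I) \<and> \<bar>I - G\<bar> \<le> c / 4"
      if W: "angular_solution \<phi> W {0..2*pi}" "\<bar>W 0 - w0\<bar> \<le> \<kappa>"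
        and V: "angular_solution \<phi> V {0..2*pi}" "\<bar>V 0 - w0\<bar> \<le> \<kappa>" and neq: "W 0 \<noteq> V 0" for W V
    proof -
      have "\<exists>I. W (2*pi) - V (2*pi) = (W 0 - V 0) * exp (\<delta> * I) \<and>
          \<bar>I - integral {0..2*pi} (\<lambda>t. poly (?E p) (exp w0 * cos t))\<bar> \<le> C * (2 * \<kappa>) * (2 * pi)"
      proof (rule period_ratio[OF W(1) V(1) _ inner \<delta>0 C(2)])
        fix t \<xi> assume t: "t \<in> {0..2*pi}" and \<xi>: "\<xi> \<in> closed_segment (W t) (V t)"
        have "\<bar>\<xi> - w0\<bar> \<le> 2 * \<kappa>"
          using \<xi> near(1)[OF W t] near(1)[OF V t] by (auto simp: closed_segment_eq_real_ivl split: if_splits)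
        then show "\<bar>poly (?E p) (exp \<xi> * cos t) - poly (?E p) (exp w0 * cos t)\<bar> \<le> C * (2 * \<kappa>)"
          by (rule Lip0)
      qed (use near(2)[OF W] near(2)[OF V] neq in \<open>auto intro!: continuous_intros\<close>)
      then show ?thesis
        using C\<kappa>_pi unfolding G_def circle_mean_def by fastforce
    qed
    have multiplier_neq_1: "exp (\<delta> * I) \<noteq> 1" if "\<bar>I - G\<bar> \<le> c / 4" for I
      using that \<delta> \<open>c > 0\<close> by (auto simp: c_def)
    have unique: "W 0 = V 0"
      if W: "angular_solution \<phi> W {0..2*pi}" "\<bar>W 0 - w0\<bar> \<le> \<kappa>" "W (2*pi) = W 0"
        and V: "angular_solution \<phi> V {0..2*pi}" "\<bar>V 0 - w0\<bar> \<le> \<kappa>" "V (2*pi) = V 0" for W V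
    proof (rule ccontr)
      assume neq: "W 0 \<noteq> V 0"
      from ratio[OF W(1,2) V(1,2) neq] obtain I where
        "W 0 - V 0 = (W 0 - V 0) * exp (\<delta> * I)" "\<bar>I - G\<bar> \<le> c / 4"
        using W V by auto
      with neq multiplier_neq_1 show False by auto
    qed
    have "\<delta> * C * 10 < 1" using \<delta>C \<kappa> by simp
    then have "\<exists>S. a \<le> -9 \<longrightarrow> S 0 = a \<and> angular_solution \<phi> S {-10<..<10}" for a
      using angular_solution_exists[OF _ inner \<delta>0 C(1,2)] by blast
    then obtain S where S: "\<And>a. a \<le> -9 \<Longrightarrow> S a 0 = a"
      "\<And>a. a \<le> -9 \<Longrightarrow> angular_solution \<phi> (S a) {-10<..<10}"
      by metis
    have sub: "{0..2*pi} \<subseteq> {-10<..<10::real}" using pi_less_4 by auto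
    have zone: "a \<le> -9" if "\<bar>a - w0\<bar> \<le> \<kappa>" for a using that w0 \<kappa> by simp
    have S_sol: "angular_solution \<phi> (S a) {0..2*pi}" "\<bar>S a 0 - w0\<bar> \<le> \<kappa>" "S a 0 = a"
      if "\<bar>a - w0\<bar> \<le> \<kappa>" for a
      using S[OF zone[OF that]] angular_solution_subset sub that by auto
    have displacement: "\<exists>e. S (w0 + h) (2*pi) - (w0 + h) = \<delta> * (h * G + e) \<and> \<bar>e\<bar> \<le> \<kappa> * c / 8"
      if h: "\<bar>h\<bar> = \<kappa> / 2" for h
    proof -
      let ?a = "w0 + h"
      have "\<bar>?a - w0\<bar> \<le> \<kappa>" using h \<kappa> by simp
      note sol = S_sol[OF this] and a9 = zone[OF this]
      note cont = angular_solution_continuous_on[OF sol(1)]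
      let ?g = "\<lambda>t. poly p (exp (S ?a t) * cos t)"
      \<comment> \<open>the remainder of the Taylor expansion at \<open>w0\<close> along the solution; its constant term
        has mean zero and its linear term has mean \<open>h G\<close>\<close>
      let ?r = "\<lambda>t. ?g t - poly p (exp w0 * cos t) - h * poly (?E p) (exp w0 * cos t)"
      have cont_g: "continuous_on {0..2*pi} ?g" by (intro continuous_intros cont)
      have "((\<lambda>t. \<delta> * ?g t) has_integral (S ?a (2*pi) - S ?a 0)) {0..2*pi}"
      proof (rule fundamental_theorem_of_calculus)
        fix t assume t: "t \<in> {0..2*pi}"
        have "S ?a t \<le> -1" by (rule near(2)[OF sol(1,2) t])
        then have "\<phi> (exp (S ?a t) * cos t) = \<delta> * ?g t"
          by (intro inner abs_exp_cos_le_half)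
        moreover from sol(1) t
        have "(S ?a has_real_derivative \<phi> (exp (S ?a t) * cos t)) (at t within {0..2*pi})"
          by (simp add: angular_solution_def)
        ultimately show "(S ?a has_vector_derivative \<delta> * ?g t) (at t within {0..2*pi})"
          by (simp only: has_real_derivative_iff_has_vector_derivative)
      qed simp
      then have D: "S ?a (2*pi) - ?a = \<delta> * integral {0..2*pi} ?g"
        using sol(3) by (simp flip: integral_mult_right add: integral_unique)
      have "(?r has_integral (integral {0..2*pi} ?g - circle_mean p (exp w0) - h * G)) {0..2*pi}"
        unfolding G_def circle_mean_def
        by (intro has_integral_diff has_integral_mult_right integrable_integral
              integrable_continuous_interval continuous_intros cont_g cont)
      then have r: "integral {0..2*pi} ?r = integral {0..2*pi} ?g - h * G"
        using zero by (simp add: integral_unique)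
      have "norm (integral {0..2*pi} ?r) \<le> (C * (8 * \<delta> * C) + C * (\<kappa> / 2 * (\<kappa> / 2))) * (2 * pi - 0)"
      proof (rule integral_bound)
        show "continuous_on {0..2*pi} ?r" by (intro continuous_intros cont)
        fix t assume t: "t \<in> {0..2*pi}"
        have "\<bar>?g t - poly p (exp ?a * cos t)\<bar> \<le> C * \<bar>S ?a t - ?a\<bar>"
          using near(2)[OF sol(1,2) t] a9 by (intro poly_exp_Lipschitz C(2)) auto
        also have "\<dots> \<le> C * (8 * \<delta> * C)"
          using var(2)[OF sol(1) t, of 0] sol(3) a9 \<open>C \<ge> 1\<close> by (intro mult_left_mono) auto
        finally have 1: "\<bar>?g t - poly p (exp ?a * cos t)\<bar> \<le> C * (8 * \<delta> * C)" .
        obtain \<xi> where \<xi>: "\<xi> \<in> closed_segment ?a w0"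
          "poly p (exp ?a * cos t) - poly p (exp w0 * cos t) = (?a - w0) * poly (?E p) (exp \<xi> * cos t)"
          by (rule poly_exp_diff)
        have \<xi>': "\<bar>\<xi> - w0\<bar> \<le> \<kappa> / 2" "\<xi> \<le> 0"
          using \<xi>(1) h w0 a9 by (auto simp: closed_segment_eq_real_ivl split: if_splits)
        have "\<bar>poly p (exp ?a * cos t) - poly p (exp w0 * cos t) - h * poly (?E p) (exp w0 * cos t)\<bar>
            = \<kappa> / 2 * \<bar>poly (?E p) (exp \<xi> * cos t) - poly (?E p) (exp w0 * cos t)\<bar>"
          unfolding \<xi>(2) using h by (simp add: abs_mult flip: right_diff_distrib)
        also have "\<dots> \<le> \<kappa> / 2 * (C * \<bar>\<xi> - w0\<bar>)"
          using \<xi>' w0 \<kappa> by (intro mult_left_mono Lip) auto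
        also have "\<dots> \<le> \<kappa> / 2 * (C * (\<kappa> / 2))"
          using \<xi>' \<kappa> \<open>C \<ge> 1\<close> by (intro mult_left_mono) auto
        also have "\<kappa> / 2 * (C * (\<kappa> / 2)) = C * (\<kappa> / 2 * (\<kappa> / 2))" by simp
        finally show "norm (?r t) \<le> C * (8 * \<delta> * C) + C * (\<kappa> / 2 * (\<kappa> / 2))"
          using 1 unfolding real_norm_def by linarith
      qed simp
      also have "\<dots> \<le> 8 * (C * (8 * \<delta> * C) + C * (\<kappa> / 2 * (\<kappa> / 2)))"
        unfolding diff_0_right using \<open>C \<ge> 1\<close> \<delta> \<kappa> by (intro scale_pi) auto
      also have "\<dots> = 64 * (\<delta> * C * C) + \<kappa> * (16 * (C * \<kappa>)) / 8" by (simp add: algebra_simps)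
      also have "\<dots> \<le> \<kappa> * c / 8"
      proof -
        have "\<kappa> * (16 * (C * \<kappa>)) \<le> \<kappa> * (c / 4)" using \<kappa> by (intro mult_left_mono C\<kappa>) auto
        then have "\<kappa> * (16 * (C * \<kappa>)) \<le> \<kappa> * c / 4" by simp
        moreover have "\<kappa> * c \<ge> 0" using \<kappa> \<open>c > 0\<close> by simp
        ultimately show ?thesis using \<delta>CC by linarith
      qed
      finally have "\<bar>integral {0..2*pi} ?g - h * G\<bar> \<le> \<kappa> * c / 8" unfolding r by simp
      then show ?thesis
        using D by (intro exI[of _ "integral {0..2*pi} ?g - h * G"]) simp
    qed
    have growth: "\<bar>S x t - S y t\<bar> \<le> exp 1 * \<bar>x - y\<bar>"
      if xy: "\<bar>x - w0\<bar> \<le> \<kappa>" "\<bar>y - w0\<bar> \<le> \<kappa>" and t: "t \<in> {0..2*pi}" for x y t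
    proof -
      note sx = S_sol[OF xy(1)] and sy = S_sol[OF xy(2)]
      have "\<delta> * C * \<bar>t - 0\<bar> \<le> \<delta> * C * 8"
        using t pi_less_4 \<delta> \<open>C \<ge> 1\<close> by (intro mult_left_mono) auto
      also have "\<dots> \<le> 1" using \<delta>C \<kappa> by simp
      finally have e1: "exp (\<delta> * C * \<bar>t - 0\<bar>) \<le> exp 1" by simp
      have "\<bar>S x t - S y t\<bar> \<le> \<bar>S x 0 - S y 0\<bar> * exp (\<delta> * C * \<bar>t - 0\<bar>)"
        by (rule angular_solutions_difference(2)[OF sx(1) sy(1) _ inner \<delta>0 C(2)])
           (use near(2)[OF sx(1,2)] near(2)[OF sy(1,2)] t in auto)
      also have "\<dots> \<le> \<bar>S x 0 - S y 0\<bar> * exp 1" by (intro mult_left_mono e1) auto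
      finally show ?thesis using sx(3) sy(3) by (simp add: mult.commute)
    qed
    have "\<exists>b. w0 - \<kappa> / 2 \<le> b \<and> b \<le> w0 + \<kappa> / 2 \<and> S b (2*pi) - b = 0"
    proof -
      have "(exp 1)-lipschitz_on {w0 - \<kappa> / 2..w0 + \<kappa> / 2} (\<lambda>a. S a (2*pi))"
        by (rule lipschitz_onI) (use growth[where t = "2*pi"] \<kappa> in \<open>auto simp: dist_real_def\<close>)
      then have cont: "continuous_on {w0 - \<kappa> / 2..w0 + \<kappa> / 2} (\<lambda>a. S a (2*pi) - a)"
        by (intro continuous_intros lipschitz_on_continuous_on)
      obtain e e' where e: "S (w0 + \<kappa> / 2) (2*pi) - (w0 + \<kappa> / 2) = \<delta> * (\<kappa> / 2 * G + e)" "\<bar>e\<bar> \<le> \<kappa> * c / 8"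
        and e': "S (w0 - \<kappa> / 2) (2*pi) - (w0 - \<kappa> / 2) = \<delta> * (- (\<kappa> / 2) * G + e')" "\<bar>e'\<bar> \<le> \<kappa> * c / 8"
        using displacement[of "\<kappa> / 2"] displacement[of "- (\<kappa> / 2)"] \<kappa> by auto
      have \<kappa>c: "\<kappa> * c > 0" using \<kappa> \<open>c > 0\<close> by simp
      show ?thesis
      proof (cases "G > 0")
        case True
        then have "\<kappa> / 2 * G = \<kappa> * c / 2" by (simp add: c_def)
        then have "0 \<le> \<kappa> / 2 * G + e" "- (\<kappa> / 2) * G + e' \<le> 0" using e(2) e'(2) \<kappa>c by linarith+
        then have "0 \<le> \<delta> * (\<kappa> / 2 * G + e)" "\<delta> * (- (\<kappa> / 2) * G + e') \<le> 0"
          using \<delta>0 by (simp_all only: mult_nonneg_nonneg mult_nonneg_nonpos)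
        then show ?thesis
          unfolding e(1)[symmetric] e'(1)[symmetric] using \<kappa> by (intro IVT' cont) simp_all
      next
        case False
        then have "\<kappa> / 2 * G = - (\<kappa> * c / 2)" by (simp add: c_def)
        then have "\<kappa> / 2 * G + e \<le> 0" "0 \<le> - (\<kappa> / 2) * G + e'" using e(2) e'(2) \<kappa>c by linarith+
        then have "\<delta> * (\<kappa> / 2 * G + e) \<le> 0" "0 \<le> \<delta> * (- (\<kappa> / 2) * G + e')"
          using \<delta>0 by (simp_all only: mult_nonneg_nonneg mult_nonneg_nonpos)
        then show ?thesis
          unfolding e(1)[symmetric] e'(1)[symmetric] using \<kappa> by (intro IVT2' cont) simp_all
      qed
    qed
    then obtain b where "w0 - \<kappa> / 2 \<le> b" "b \<le> w0 + \<kappa> / 2" "S b (2*pi) - b = 0" by blast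
    then have b: "\<bar>b - w0\<bar> \<le> \<kappa> / 2" "S b (2*pi) = b" by linarith+
    then have b_zone: "\<bar>b - w0\<bar> \<le> \<kappa>" using \<kappa> by simp
    note Sb = S_sol[OF b_zone]
    let ?m = "\<lambda>t. poly (?E p) (exp (S b t) * cos t)"
    define J where "J = integral {0..2*pi} ?m"
    have cont_m: "continuous_on {0..2*pi} ?m"
      by (intro continuous_intros angular_solution_continuous_on[OF Sb(1)])
    have "\<bar>J - G\<bar> \<le> c / 4"
    proof -
      let ?r = "\<lambda>t. ?m t - poly (?E p) (exp w0 * cos t)"
      have "norm (integral {0..2*pi} ?r) \<le> C * (2 * \<kappa>) * (2 * pi - 0)"
        by (rule integral_bound)
           (use near(1)[OF Sb(1,2)] Lip0 in \<open>auto intro!: continuous_intros angular_solution_continuous_on[OF Sb(1)]\<close>)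
      moreover have "integral {0..2*pi} ?r = J - G"
        unfolding J_def G_def circle_mean_def
        by (intro integral_diff integrable_continuous_interval cont_m continuous_intros)
      ultimately show ?thesis using C\<kappa>_pi by simp
    qed
    then have d: "exp (\<delta> * J) \<noteq> 1" by (rule multiplier_neq_1)
    have "\<exists>I. \<bar>a - w0\<bar> < \<kappa> \<and> a \<noteq> b \<longrightarrow>
        S a (2*pi) - S b (2*pi) = (a - b) * exp (\<delta> * I) \<and> \<bar>I - J\<bar> \<le> 8 * (C * (exp 1 * \<bar>a - b\<bar>))" for a
    proof (cases "\<bar>a - w0\<bar> < \<kappa> \<and> a \<noteq> b")
      case True
      then have a_zone: "\<bar>a - w0\<bar> \<le> \<kappa>" by simp
      note Sa = S_sol[OF a_zone]
      have "\<exists>I. S a (2*pi) - S b (2*pi) = (S a 0 - S b 0) * exp (\<delta> * I) \<and>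
          \<bar>I - integral {0..2*pi} ?m\<bar> \<le> C * (exp 1 * \<bar>a - b\<bar>) * (2 * pi)"
      proof (rule period_ratio[OF Sa(1) Sb(1) _ inner \<delta>0 C(2) cont_m])
        fix t \<xi> assume t: "t \<in> {0..2*pi}" and \<xi>: "\<xi> \<in> closed_segment (S a t) (S b t)"
        have "\<bar>\<xi> - S b t\<bar> \<le> exp 1 * \<bar>a - b\<bar>" "\<xi> \<le> 0"
          using \<xi> growth[OF a_zone b_zone t] near(2)[OF Sa(1,2) t] near(2)[OF Sb(1,2) t]
          by (auto simp: closed_segment_eq_real_ivl split: if_splits)
        then have "C * \<bar>\<xi> - S b t\<bar> \<le> C * (exp 1 * \<bar>a - b\<bar>)"
          and "\<bar>poly (?E p) (exp \<xi> * cos t) - ?m t\<bar> \<le> C * \<bar>\<xi> - S b t\<bar>"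
          using \<open>C \<ge> 1\<close> near(2)[OF Sb(1,2) t] by (auto intro!: mult_left_mono Lip)
        then show "\<bar>poly (?E p) (exp \<xi> * cos t) - ?m t\<bar> \<le> C * (exp 1 * \<bar>a - b\<bar>)" by linarith
      qed (use near(2)[OF Sa(1,2)] near(2)[OF Sb(1,2)] True Sa(3) Sb(3) in auto)
      moreover have "C * (exp 1 * \<bar>a - b\<bar>) * (2 * pi) \<le> 8 * (C * (exp 1 * \<bar>a - b\<bar>))"
        using \<open>C \<ge> 1\<close> by (intro scale_pi) auto
      ultimately obtain I where "S a (2*pi) - S b (2*pi) = (a - b) * exp (\<delta> * I)"
        "\<bar>I - J\<bar> \<le> 8 * (C * (exp 1 * \<bar>a - b\<bar>))"
        unfolding J_def[symmetric] Sa(3) Sb(3) by (meson order_trans)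
      then show ?thesis by blast
    qed auto
    \<comment> \<open>\<open>\<delta> (I a)\<close> is the logarithm of the difference quotient of the period map at \<open>b\<close>\<close>
    then obtain I where I:
      "\<And>a. \<bar>a - w0\<bar> < \<kappa> \<Longrightarrow> a \<noteq> b \<Longrightarrow> S a (2*pi) - S b (2*pi) = (a - b) * exp (\<delta> * I a)"
      "\<And>a. \<bar>a - w0\<bar> < \<kappa> \<Longrightarrow> a \<noteq> b \<Longrightarrow> \<bar>I a - J\<bar> \<le> 8 * (C * (exp 1 * \<bar>a - b\<bar>))"
      by metis
    have "b \<in> {w0 - \<kappa><..<w0 + \<kappa>}" 
      unfolding greaterThanLessThan_iff using b(1) \<kappa>(1) by (intro conjI) linarith+
    then have ev: "\<forall>\<^sub>F a in at b. \<bar>a - w0\<bar> < \<kappa> \<and> a \<noteq> b"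
      unfolding eventually_at_topological
      by (intro exI[of _ "{w0 - \<kappa><..<w0 + \<kappa>}"]) (auto simp: abs_less_iff)
    have "((\<lambda>a. I a - J) \<longlongrightarrow> 0) (at b)"
    proof (rule Lim_null_comparison)
      show "\<forall>\<^sub>F a in at b. norm (I a - J) \<le> 8 * (C * (exp 1 * \<bar>a - b\<bar>))"
        using ev by eventually_elim (use I(2) in auto)
      show "((\<lambda>a. 8 * (C * (exp 1 * \<bar>a - b\<bar>))) \<longlongrightarrow> 0) (at b)"
        by (auto intro!: tendsto_eq_intros)
    qed
    then have "(I \<longlongrightarrow> J) (at b)" by (rule LIM_zero_cancel)
    then have "((\<lambda>a. exp (\<delta> * I a)) \<longlongrightarrow> exp (\<delta> * J)) (at b)" by (intro tendsto_intros)
    then have "((\<lambda>a. (S a (2*pi) - S b (2*pi)) / (a - b)) \<longlongrightarrow> exp (\<delta> * J)) (at b)"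
      by (rule Lim_transform_eventually) (use ev in eventually_elim, use I(1) in auto)
    then have "((\<lambda>a. S a (2*pi)) has_real_derivative exp (\<delta> * J)) (at b)"
      by (simp add: has_field_derivative_iff)
    moreover have "\<bar>W s - W t\<bar> \<le> \<kappa> / 8"
      if "angular_solution \<phi> W {0..2*pi}" "s \<in> {0..2*pi}" "t \<in> {0..2*pi}" "\<bar>W t - w0\<bar> \<le> 1" for W s t
    proof -
      have "W t \<le> -9" using that(4) w0 by linarith
      from var(2)[OF that(1-3) this] \<delta>C show ?thesis by linarith
    qed
    moreover have "W 0 = b"
      if "angular_solution \<phi> W {0..2*pi}" "\<bar>W 0 - w0\<bar> < \<kappa>" "W (2*pi) = W 0" for W
      using unique[OF that(1) _ that(3) Sb(1,2)] that(2) Sb(3) b(2) by simp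
    moreover have "S a 0 = a \<and> angular_solution \<phi> (S a) {-10<..<10}" if "\<bar>a - w0\<bar> < \<kappa>" for a
      using S[OF zone[of a]] that by auto
    ultimately show ?thesis
      unfolding hyperbolic_angular_cycle_def using b d
      by (intro conjI exI[of _ S] exI[of _ b] exI[of _ "exp (\<delta> * J)"]) blast+
  qed
  ultimately show thesis using that \<kappa> by blast
qed

section \<open>From the angular equation to planar limit cycles\<close>

definition foci_field :: "(real \<Rightarrow> real) \<Rightarrow> real \<Rightarrow> planar_field" where
  "foci_field \<phi> \<epsilon> = (\<lambda>(x, y). (\<phi> (x / \<epsilon>) * x - y, x + \<phi> (x / \<epsilon>) * y))"

definition polar_point :: "real \<Rightarrow> real \<Rightarrow> real \<Rightarrow> real \<times> real" where
  "polar_point \<epsilon> w t = (\<epsilon> * exp w * cos t, \<epsilon> * exp w * sin t)"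

text \<open>
  The two linear fields are \<open>J + id\<close> and \<open>J - id\<close> with the quarter turn \<open>J\<close>: an unstable and a
  stable focus turning with the same unit speed.
\<close>

lemma linear_regularization_foci:
  "linear_regularization \<phi> (\<lambda>(x, y). (x - y, x + y)) (\<lambda>(x, y). (- x - y, x - y)) \<epsilon> = foci_field \<phi> \<epsilon>"
  by (auto simp: linear_regularization_def foci_field_def fun_eq_iff field_simps)

lemma norm_polar_point: "\<epsilon> > 0 \<Longrightarrow> norm (polar_point \<epsilon> w t) = \<epsilon> * exp w"
proof -
  assume "\<epsilon> > 0"
  have "(\<epsilon> * exp w * cos t)\<^sup>2 + (\<epsilon> * exp w * sin t)\<^sup>2 = (\<epsilon> * exp w)\<^sup>2 * ((sin t)\<^sup>2 + (cos t)\<^sup>2)"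
    by (simp only: power_mult_distrib distrib_left add.commute)
  then show ?thesis using \<open>\<epsilon> > 0\<close> by (simp add: polar_point_def norm_Pair)
qed

lemma angular_solution_imp_solution_on:
  assumes W: "angular_solution \<phi> W I" and \<epsilon>: "\<epsilon> > 0"
  shows "solution_on (foci_field \<phi> \<epsilon>) I (\<lambda>t. polar_point \<epsilon> (W t) t)"
  unfolding solution_on_def
proof
  fix t assume "t \<in> I"
  with W have d: "(W has_real_derivative \<phi> (exp (W t) * cos t)) (at t within I)"
    by (simp add: angular_solution_def)
  let ?f = "\<phi> (exp (W t) * cos t)"
  have "((\<lambda>t. \<epsilon> * exp (W t) * cos t) has_real_derivative
          ?f * (\<epsilon> * exp (W t) * cos t) - \<epsilon> * exp (W t) * sin t) (at t within I)"
    by (auto intro!: derivative_eq_intros d simp: algebra_simps)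
  moreover have "((\<lambda>t. \<epsilon> * exp (W t) * sin t) has_real_derivative
          \<epsilon> * exp (W t) * cos t + ?f * (\<epsilon> * exp (W t) * sin t)) (at t within I)"
    by (auto intro!: derivative_eq_intros d simp: algebra_simps)
  ultimately show "((\<lambda>t. polar_point \<epsilon> (W t) t) has_vector_derivative
      foci_field \<phi> \<epsilon> (polar_point \<epsilon> (W t) t)) (at t within I)"
    unfolding has_real_derivative_iff_has_vector_derivative polar_point_def foci_field_def
    using \<epsilon> by (auto intro!: has_vector_derivative_Pair)
qed

text \<open>
  Seen from axes that rotate with unit speed the solution satisfies \<open>p' = f p\<close> and \<open>q' = f q\<close> with
  one and the same scalar \<open>f\<close>, so it stays on the ray on which it starts: the polar angle is
  exactly the time, and the logarithm of the radius solves the angular equation.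
\<close>

lemma solution_on_imp_angular_solution:
  assumes \<gamma>: "solution_on (foci_field \<phi> \<epsilon>) UNIV \<gamma>" and \<epsilon>: "\<epsilon> > 0"
    and le1: "\<And>x. \<bar>\<phi> x\<bar> \<le> 1" and start: "\<gamma> \<tau> = polar_point \<epsilon> c \<tau>"
  obtains W where "angular_solution \<phi> W UNIV" "W \<tau> = c" "\<And>t. \<gamma> t = polar_point \<epsilon> (W t) t"
proof -
  define x where "x t = fst (\<gamma> t)" for t
  define y where "y t = snd (\<gamma> t)" for t
  define f where "f t = \<phi> (x t / \<epsilon>)" for t
  have d\<gamma>: "(\<gamma> has_vector_derivative (f t * x t - y t, x t + f t * y t)) (at t)" for t
    using \<gamma> by (simp add: solution_on_def foci_field_def case_prod_unfold f_def x_def y_def)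
  have dx: "(x has_real_derivative f t * x t - y t) (at t)" for t
    using bounded_linear.has_vector_derivative[OF bounded_linear_fst d\<gamma>[of t]]
    by (simp add: has_real_derivative_iff_has_vector_derivative x_def[abs_def])
  have dy: "(y has_real_derivative x t + f t * y t) (at t)" for t
    using bounded_linear.has_vector_derivative[OF bounded_linear_snd d\<gamma>[of t]]
    by (simp add: has_real_derivative_iff_has_vector_derivative y_def[abs_def])
  define p where "p t = x t * cos t + y t * sin t" for t
  define q where "q t = - x t * sin t + y t * cos t" for t
  have dp: "(p has_real_derivative f t * p t) (at t)" for t
    unfolding p_def by (auto intro!: derivative_eq_intros dx dy simp: algebra_simps)
  have dq: "(q has_real_derivative f t * q t) (at t)" for t
    unfolding q_def by (auto intro!: derivative_eq_intros dx dy simp: algebra_simps)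
  have f1: "\<bar>f t * z\<bar> \<le> 1 * \<bar>z\<bar>" for t z
    unfolding abs_mult f_def using le1 by (intro mult_right_mono) auto
  have trig: "sin t * sin t + cos t * cos t = 1" for t :: real
    using sin_cos_squared_add[of t] by (simp add: power2_eq_square)
  have "p \<tau> = \<epsilon> * exp c * (sin \<tau> * sin \<tau> + cos \<tau> * cos \<tau>)"
    unfolding p_def x_def y_def start polar_point_def fst_conv snd_conv by (simp only: algebra_simps)
  then have p\<tau>: "p \<tau> = \<epsilon> * exp c" by (simp only: trig mult_1_right)
  have q\<tau>: "q \<tau> = 0"
    by (simp add: q_def x_def y_def start polar_point_def)
  have q0: "q t = 0" for t
    using linear_growth_bound[of UNIV \<tau> t q "\<lambda>t. f t * q t" 1] dq f1 q\<tau> by simp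
  have "p \<tau> > 0" using p\<tau> \<epsilon> by simp
  have p_nz: "p t \<noteq> 0" for t
    using linear_growth_bound[of UNIV t \<tau> p "\<lambda>t. f t * p t" 1] dp f1 \<open>p \<tau> > 0\<close> by auto
  have p_pos: "p t > 0" for t
  proof (rule ccontr)
    assume neg: "\<not> p t > 0"
    have "connected (range p)"
      by (intro connected_continuous_image continuous_at_imp_continuous_on ballI DERIV_isCont[OF dp]) auto
    then have "0 \<in> range p"
      using neg \<open>p \<tau> > 0\<close> connectedD_interval[of "range p" "p t" "p \<tau>" 0] by auto
    with p_nz show False by auto
  qed
  have xy: "x t = p t * cos t" "y t = p t * sin t" for t
  proof -
    have "p t * cos t - q t * sin t = x t * (sin t * sin t + cos t * cos t)"
      unfolding p_def q_def by algebra
    moreover have "p t * sin t + q t * cos t = y t * (sin t * sin t + cos t * cos t)"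
      unfolding p_def q_def by algebra
    ultimately show "x t = p t * cos t" "y t = p t * sin t" by (simp_all add: q0 trig)
  qed
  define W where "W t = ln (p t / \<epsilon>)" for t
  have expW: "exp (W t) = p t / \<epsilon>" for t using p_pos[of t] \<epsilon> by (simp add: W_def)
  have "(W has_real_derivative \<phi> (exp (W t) * cos t)) (at t)" for t
  proof -
    have "((\<lambda>t. ln (p t / \<epsilon>)) has_real_derivative f t) (at t)"
      using p_pos[of t] \<epsilon> by (auto intro!: derivative_eq_intros dp simp: field_simps)
    moreover have "f t = \<phi> (exp (W t) * cos t)"
      unfolding f_def xy expW by (simp add: field_simps)
    ultimately show ?thesis by (simp add: W_def[abs_def])
  qed
  moreover have "W \<tau> = c" using p\<tau> \<epsilon> by (simp add: W_def)
  moreover have "\<gamma> t = polar_point \<epsilon> (W t) t" for t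
    using \<epsilon> by (simp add: polar_point_def expW prod_eq_iff flip: x_def y_def xy)
  ultimately show thesis using that[of W] by (simp add: angular_solution_def)
qed

lemma angular_solution_unique:
  assumes W: "angular_solution \<phi> W I" and V: "angular_solution \<phi> V I"
    and \<phi>: "transition_function \<phi>" and I: "is_interval I" "s \<in> I" "t \<in> I" and eq: "W s = V s"
  shows "W t = V t"
proof -
  obtain L where L: "L \<ge> 0" "\<And>c a b. \<bar>\<phi> (exp a * c) - \<phi> (exp b * c)\<bar> \<le> L * \<bar>a - b\<bar>"
    using transition_function_exp_Lipschitz[OF \<phi>] by blast
  have "\<bar>W t - V t\<bar> \<le> \<bar>W s - V s\<bar> * exp (L * \<bar>t - s\<bar>)"
    by (rule linear_growth_bound[where u = "\<lambda>t. W t - V t", OF I])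
       (use W V L(2) in \<open>auto simp: angular_solution_def intro!: DERIV_diff\<close>)
  with eq show ?thesis by simp
qed

lemma angular_solution_shift:
  assumes W: "angular_solution \<phi> W UNIV" and c: "\<And>t. cos (t + c) = cos t"
  shows "angular_solution \<phi> (\<lambda>t. W (t + c)) UNIV"
proof -
  have "((\<lambda>t. W (t + c)) has_real_derivative \<phi> (exp (W (t + c)) * cos t)) (at t)" for t
  proof -
    have "(W has_real_derivative \<phi> (exp (W (t + c)) * cos (t + c))) (at (t + c))"
      using W by (simp add: angular_solution_def)
    then show ?thesis unfolding DERIV_shift c .
  qed
  then show ?thesis by (simp add: angular_solution_def)
qed

text \<open>
  The period map is increasing, so an orbit that closes up after several turns does so after
  the first: \<open>W (t + 2\<pi>) - W t\<close> has no zero unless it vanishes identically, and with constant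
  sign the values \<open>W (2\<pi>m)\<close> would be strictly monotone in \<open>m\<close>.
\<close>

lemma angular_solution_period:
  assumes W: "angular_solution \<phi> W UNIV" and \<phi>: "transition_function \<phi>"
    and n: "n > 0" "W (2 * pi * real n) = W 0"
  shows "W (2 * pi) = W 0"
proof (rule ccontr)
  assume neq: "W (2 * pi) \<noteq> W 0"
  define u where "u t = W (t + 2 * pi) - W t" for t
  have W': "angular_solution \<phi> (\<lambda>t. W (t + 2 * pi)) UNIV"
    by (rule angular_solution_shift[OF W]) simp
  have nz: "u t \<noteq> 0" for t
    using angular_solution_unique[OF W' W \<phi>, of t 0] neq by (auto simp: u_def)
  have cont: "continuous_on UNIV u"
    unfolding u_def using angular_solution_continuous_on[OF W] angular_solution_continuous_on[OF W']
    by (intro continuous_intros)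
  then have "connected (range u)" by (intro connected_continuous_image) auto
  then have sign: "\<not> (u s < 0 \<and> u t > 0)" for s t
    using connectedD_interval[of "range u" "u s" "u t" 0] nz by force
  have step: "W (2 * pi * real (Suc m)) = W (2 * pi * real m) + u (2 * pi * real m)" for m
    by (simp add: u_def algebra_simps)
  show False
  proof (cases "u 0 > 0")
    case True
    then have "u t > 0" for t using sign[of t 0] nz[of t] by (auto simp: neq_iff)
    then have u: "u (2 * pi * real m) > 0" for m by blast
    have "W (2 * pi * real (Suc m)) > W 0" for m
    proof (induction m)
      case 0
      then show ?case using u[of 0] step[of 0] by simp
    next
      case (Suc m)
      then show ?case using u[of "Suc m"] step[of "Suc m"] by linarith
    qed
    from this[of "n - 1"] n show False by simp
  next
    case False
    then have "u t < 0" for t using sign[of 0 t] nz[of 0] nz[of t] by (auto simp: neq_iff)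
    then have u: "u (2 * pi * real m) < 0" for m by blast
    have "W (2 * pi * real (Suc m)) < W 0" for m
    proof (induction m)
      case 0
      then show ?case using u[of 0] step[of 0] by simp
    next
      case (Suc m)
      then show ?case using u[of "Suc m"] step[of "Suc m"] by linarith
    qed
    from this[of "n - 1"] n show False by simp
  qed
qed

text \<open>
  Near a multiple of the period the repeated pieces agree with one of them on a whole
  neighbourhood, because \<open>S\<close> and its shift solve the same equation beyond the end points of
  the period; so the extension is differentiable there too.
\<close>

lemma periodic_extension:
  assumes S: "angular_solution \<phi> S {-10<..<10}" and per: "S (2 * pi) = S 0"
    and \<phi>: "transition_function \<phi>"
  obtains V where "angular_solution \<phi> V UNIV" "\<And>t. V (t + 2 * pi) = V t"
    "\<And>t. t \<in> {0..2*pi} \<Longrightarrow> V t = S t" "\<And>t. \<exists>s\<in>{0..2*pi}. V t = V s"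
proof -
  define n :: "real \<Rightarrow> int" where "n t = \<lfloor>t / (2 * pi)\<rfloor>" for t
  define V where "V t = S (t - 2 * pi * of_int (n t))" for t
  have n_eqI: "n t = k" if "2 * pi * of_int k \<le> t" "t < 2 * pi * of_int k + 2 * pi" for t k
    unfolding n_def using that by (intro floor_unique) (simp_all add: field_simps)
  have n: "0 \<le> t - 2 * pi * of_int (n t)" "t - 2 * pi * of_int (n t) < 2 * pi" for t
  proof -
    have "of_int (n t) \<le> t / (2 * pi)" "t / (2 * pi) < of_int (n t) + 1"
      unfolding n_def by linarith+
    then show "0 \<le> t - 2 * pi * of_int (n t)" "t - 2 * pi * of_int (n t) < 2 * pi"
      by (simp_all add: field_simps)
  qed
  have overlap: "S (r + 2 * pi) = S r" if r: "r \<in> {-1<..<1}" for r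
  proof -
    have "angular_solution \<phi> (\<lambda>t. S (t + 2 * pi)) {-1<..<1}"
      unfolding angular_solution_def
    proof
      fix t :: real assume "t \<in> {-1<..<1}"
      then have "t + 2 * pi \<in> {-10<..<10}" using pi_less_4 pi_ge_two by auto
      then have "(S has_real_derivative \<phi> (exp (S (t + 2 * pi)) * cos (t + 2 * pi))) (at (t + 2 * pi))"
        using S unfolding angular_solution_def by (metis at_within_open open_greaterThanLessThan)
      then have "((\<lambda>t. S (t + 2 * pi)) has_real_derivative \<phi> (exp (S (t + 2 * pi)) * cos t)) (at t)"
        unfolding DERIV_shift by simp
      then show "((\<lambda>t. S (t + 2 * pi)) has_real_derivative \<phi> (exp (S (t + 2 * pi)) * cos t)) (at t within {-1<..<1})"
        by (rule has_field_derivative_at_within)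
    qed
    moreover have "angular_solution \<phi> S {-1<..<1}"
      by (rule angular_solution_subset[OF S]) auto
    ultimately show ?thesis
      by (rule angular_solution_unique[where s = 0]) (use \<phi> r per in \<open>auto simp: is_interval_1\<close>)
  qed
  have local: "V r = S (r - 2 * pi * of_int k)"
    if r: "r \<in> {2 * pi * of_int k - 1<..<2 * pi * of_int k + 2 * pi}" for r and k
  proof (cases "2 * pi * of_int k \<le> r")
    case True
    then have "n r = k" using r by (intro n_eqI) auto
    then show ?thesis by (simp add: V_def)
  next
    case False
    have n_r: "n r = k - 1" using r False pi_ge_two by (intro n_eqI) (auto simp: algebra_simps)
    have "V r = S ((r - 2 * pi * of_int k) + 2 * pi)"
      unfolding V_def n_r by (simp add: algebra_simps)
    also have "\<dots> = S (r - 2 * pi * of_int k)" by (rule overlap) (use r False in auto)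
    finally show ?thesis .
  qed
  have V: "angular_solution \<phi> V UNIV"
    unfolding angular_solution_def
  proof
    fix t :: real
    let ?k = "n t" and ?I = "{2 * pi * of_int (n t) - 1<..<2 * pi * of_int (n t) + 2 * pi}"
    have t: "t \<in> ?I" using n[of t] by auto
    let ?c = "- (2 * pi * of_int ?k)"
    have "t + ?c \<in> {-10<..<10}" using n[of t] pi_less_4 by simp
    then have "(S has_real_derivative \<phi> (exp (S (t + ?c)) * cos (t + ?c))) (at (t + ?c))"
      using S unfolding angular_solution_def by (metis at_within_open open_greaterThanLessThan)
    moreover have "cos (t + ?c) = cos t"
      using cos.plus_of_int[of t "- ?k"] by (simp add: mult_ac)
    ultimately have "((\<lambda>t. S (t + ?c)) has_real_derivative \<phi> (exp (S (t + ?c)) * cos t)) (at t)"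
      unfolding DERIV_shift by simp
    then have "(V has_real_derivative \<phi> (exp (S (t + ?c)) * cos t)) (at t)"
      by (rule has_field_derivative_transform_within_open[where S = ?I]) (use t local in auto)
    then show "(V has_real_derivative \<phi> (exp (V t) * cos t)) (at t within UNIV)"
      using local[OF t] by simp
  qed
  have shift: "V (t + 2 * pi) = V t" for t
  proof -
    have n_shift: "n (t + 2 * pi) = n t + 1"
      using n[of t] by (intro n_eqI) (auto simp: algebra_simps)
    show ?thesis unfolding V_def n_shift by (simp add: algebra_simps)
  qed
  have inner: "V t = S t" if "t \<in> {0..2*pi}" for t
  proof (cases "t < 2 * pi")
    case True
    then have "n t = 0" using that by (intro n_eqI) auto
    then show ?thesis by (simp add: V_def)
  next
    case False
    then have "t = 2 * pi" using that by simp
    moreover have "n 0 = 0" by (intro n_eqI) auto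
    ultimately show ?thesis using shift[of 0] per by (simp add: V_def)
  qed
  have "\<exists>s\<in>{0..2*pi}. V t = V s" for t
    using n[of t] inner[of "t - 2 * pi * of_int (n t)"]
    by (intro bexI[of _ "t - 2 * pi * of_int (n t)"]) (auto simp: V_def[of t])
  with V shift inner show thesis by (rule that)
qed

lemma polar_point_exists:
  assumes "z \<noteq> 0" "\<epsilon> > 0"
  obtains \<tau> where "0 \<le> \<tau>" "\<tau> < 2 * pi" "z = polar_point \<epsilon> (ln (norm z / \<epsilon>)) \<tau>"
proof -
  let ?r = "norm z"
  have "(fst z / ?r)\<^sup>2 + (snd z / ?r)\<^sup>2 = 1"
  proof -
    have "?r\<^sup>2 = (fst z)\<^sup>2 + (snd z)\<^sup>2" by (simp add: norm_prod_def)
    then have "(fst z / ?r)\<^sup>2 + (snd z / ?r)\<^sup>2 = ?r\<^sup>2 / ?r\<^sup>2"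
      by (simp only: power_divide add_divide_distrib)
    with assms show ?thesis by simp
  qed
  then obtain \<tau> where "0 \<le> \<tau>" "\<tau> < 2 * pi" "fst z / ?r = cos \<tau>" "snd z / ?r = sin \<tau>"
    by (rule sincos_total_2pi)
  moreover from this assms have "fst z = ?r * cos \<tau>" "snd z = ?r * sin \<tau>"
    by (simp_all add: field_simps)
  moreover have "\<epsilon> * exp (ln (?r / \<epsilon>)) = ?r" using assms by simp
  ultimately show thesis
    by (intro that[of \<tau>] prod_eqI) (simp_all only: polar_point_def fst_conv snd_conv)
qed

text \<open>
  The orbit of the periodic solution is isolated because every periodic orbit meeting a thin
  annulus around it is described by a solution \<open>W\<close> of the angular equation that starts near \<open>w0\<close>
  and, by \<open>angular_solution_period\<close>, returns after one turn. The positive \<open>x\<close>-axis is a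
  transversal section on which the return map is the period map conjugated by \<open>exp\<close>; at the
  fixed point the conjugation does not change the derivative. The bounds on \<open>\<Gamma>\<close> serve to tell
  the cycles for different \<open>w0\<close> apart.
\<close>

lemma foci_hyperbolic_limit_cycle:
  assumes \<phi>: "transition_function \<phi>" and le1: "\<And>x. \<bar>\<phi> x\<bar> \<le> 1"
    and cycle: "hyperbolic_angular_cycle \<phi> w0 \<kappa>" and \<kappa>: "0 < \<kappa>" "\<kappa> \<le> 1/4" and \<epsilon>: "\<epsilon> > 0"
  obtains \<Gamma> where "hyperbolic_limit_cycle (foci_field \<phi> \<epsilon>) \<Gamma>"
    "\<Gamma> \<noteq> {}" "\<Gamma> \<subseteq> {z. \<epsilon> * exp (w0 - 1/2) < norm z \<and> norm z < \<epsilon> * exp (w0 + 1/2)}"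
proof -
  let ?F = "foci_field \<phi> \<epsilon>"
  from cycle have var: "\<bar>W s - W t\<bar> \<le> \<kappa> / 8"
    if "angular_solution \<phi> W {0..2*pi}" "s \<in> {0..2*pi}" "t \<in> {0..2*pi}" "\<bar>W t - w0\<bar> \<le> 1" for W s t
    using that unfolding hyperbolic_angular_cycle_def by blast
  from cycle obtain S b d where
    S: "\<And>a. \<bar>a - w0\<bar> < \<kappa> \<Longrightarrow> S a 0 = a" "\<And>a. \<bar>a - w0\<bar> < \<kappa> \<Longrightarrow> angular_solution \<phi> (S a) {-10<..<10}"
    and b: "\<bar>b - w0\<bar> \<le> \<kappa> / 2" "S b (2*pi) = b"
    and d: "((\<lambda>a. S a (2*pi)) has_real_derivative d) (at b)" "d \<noteq> 1"
    and unique: "\<And>W. angular_solution \<phi> W {0..2*pi} \<Longrightarrow> \<bar>W 0 - w0\<bar> < \<kappa> \<Longrightarrow> W (2*pi) = W 0 \<Longrightarrow> W 0 = b"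
    unfolding hyperbolic_angular_cycle_def by blast
  have b_zone: "\<bar>b - w0\<bar> < \<kappa>" using b(1) \<kappa> by linarith
  have per: "S b (2*pi) = S b 0" using b(2) S(1)[OF b_zone] by simp
  obtain V where V: "angular_solution \<phi> V UNIV" "\<And>t. V (t + 2 * pi) = V t"
    "\<And>t. t \<in> {0..2*pi} \<Longrightarrow> V t = S b t" "\<And>t. \<exists>s\<in>{0..2*pi}. V t = V s"
    using periodic_extension[OF S(2)[OF b_zone] per \<phi>] by blast
  have V0: "V 0 = b" using V(3)[of 0] S(1)[OF b_zone] by simp
  have V_near: "\<bar>V t - w0\<bar> < 3 * \<kappa> / 4" for t
  proof -
    obtain s where s: "s \<in> {0..2*pi}" "V t = V s" using V(4) by blast
    have "\<bar>V s - V 0\<bar> \<le> \<kappa> / 8"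
      by (rule var[OF angular_solution_subset[OF V(1)]]) (use s V0 b(1) \<kappa> in auto)
    with s V0 b(1) \<kappa>(1) show ?thesis by linarith
  qed
  define \<gamma> where "\<gamma> t = polar_point \<epsilon> (V t) t" for t
  define \<Gamma> where "\<Gamma> = range \<gamma>"
  have sol: "solution_on ?F UNIV \<gamma>"
    unfolding \<gamma>_def[abs_def] by (rule angular_solution_imp_solution_on[OF V(1) \<epsilon>])
  have norm_\<gamma>: "norm (\<gamma> t) = \<epsilon> * exp (V t)" for t
    by (simp add: \<gamma>_def norm_polar_point[OF \<epsilon>])
  have periodic: "periodic_orbit ?F \<Gamma>"
    unfolding periodic_orbit_def
  proof (intro exI conjI allI)
    show "solution_on ?F UNIV \<gamma>" by (rule sol)
    show "2 * pi > 0" by simp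
    show "\<gamma> (t + 2 * pi) = \<gamma> t" for t by (simp add: \<gamma>_def V(2) polar_point_def)
    have "fst (\<gamma> pi) < 0" "fst (\<gamma> 0) > 0" using \<epsilon> by (simp_all add: \<gamma>_def polar_point_def)
    then show "\<gamma> pi \<noteq> \<gamma> 0" by auto
    show "\<Gamma> = range \<gamma>" by (rule \<Gamma>_def)
  qed
  define U where "U = {z :: real \<times> real. \<epsilon> * exp (w0 - 3 * \<kappa> / 4) < norm z \<and> norm z < \<epsilon> * exp (w0 + 3 * \<kappa> / 4)}"
  have "open U"
    unfolding U_def by (intro open_Collect_conj open_Collect_less continuous_intros)
  moreover have "\<Gamma> \<subseteq> U"
  proof -
    have "w0 - 3 * \<kappa> / 4 < V t" "V t < w0 + 3 * \<kappa> / 4" for t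
      using V_near[of t] by linarith+
    then have "\<gamma> t \<in> U" for t using \<epsilon> by (simp add: U_def norm_\<gamma>)
    then show ?thesis by (auto simp: \<Gamma>_def)
  qed
  moreover have "\<Gamma>' = \<Gamma>" if \<Gamma>': "periodic_orbit ?F \<Gamma>'" "\<Gamma>' \<inter> U \<noteq> {}" for \<Gamma>'
  proof -
    from \<Gamma>'(1) obtain g T where g: "solution_on ?F UNIV g" "T > 0" "\<And>t. g (t + T) = g t" "\<Gamma>' = range g"
      unfolding periodic_orbit_def by blast
    with \<Gamma>'(2) obtain t0 where t0: "g t0 \<in> U" by auto
    let ?z = "g t0"
    have "0 < \<epsilon> * exp (w0 - 3 * \<kappa> / 4)" using \<epsilon> by simp
    also have "\<dots> < norm ?z" using t0 by (simp add: U_def)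
    finally have "norm ?z > 0" .
    then have "?z \<noteq> 0" by simp
    then obtain \<tau> where \<tau>: "0 \<le> \<tau>" "\<tau> < 2 * pi" "?z = polar_point \<epsilon> (ln (norm ?z / \<epsilon>)) \<tau>"
      using \<epsilon> by (rule polar_point_exists)
    define c where "c = ln (norm ?z / \<epsilon>)"
    have exp_c: "norm ?z = \<epsilon> * exp c" using \<open>norm ?z > 0\<close> \<epsilon> by (simp add: c_def)
    then have "w0 - 3 * \<kappa> / 4 < c" "c < w0 + 3 * \<kappa> / 4"
      using t0 \<epsilon> by (simp_all add: U_def)
    then have c: "\<bar>c - w0\<bar> < 3 * \<kappa> / 4" by linarith
    \<comment> \<open>time is shifted so that the solution passes \<open>?z\<close> at the time equal to its polar angle\<close>
    define g' where "g' t = g (t + (t0 - \<tau>))" for t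
    have "(g' has_vector_derivative ?F (g' t)) (at t)" for t
    proof -
      have "(g has_vector_derivative ?F (g' t)) (at (t + (t0 - \<tau>)))"
        using g(1) by (simp add: solution_on_def g'_def)
      moreover have "((\<lambda>t. t + (t0 - \<tau>)) has_vector_derivative 1) (at t)"
        by (auto intro!: derivative_eq_intros simp flip: has_real_derivative_iff_has_vector_derivative)
      ultimately show ?thesis
        using vector_diff_chain_at[of "\<lambda>t. t + (t0 - \<tau>)" 1 t g] by (simp add: o_def g'_def[abs_def])
    qed
    then have g'_sol: "solution_on ?F UNIV g'" by (simp add: solution_on_def)
    have "g' \<tau> = polar_point \<epsilon> c \<tau>" using \<tau>(3) by (simp add: g'_def c_def)
    then obtain W where W: "angular_solution \<phi> W UNIV" "W \<tau> = c" "\<And>t. g' t = polar_point \<epsilon> (W t) t"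
      using solution_on_imp_angular_solution[OF g'_sol \<epsilon> le1] by blast
    have W': "angular_solution \<phi> W {0..2*pi}" by (rule angular_solution_subset[OF W(1)]) simp
    have "\<bar>W 0 - W \<tau>\<bar> \<le> \<kappa> / 8"
      by (rule var[OF W']) (use \<tau> W(2) c \<kappa> in auto)
    then have W0: "\<bar>W 0 - w0\<bar> < \<kappa>" using W(2) c \<kappa>(1) by linarith
    have "g' T = g' 0" using g(3)[of "t0 - \<tau>"] by (simp add: g'_def add.commute)
    then have eq: "polar_point \<epsilon> (W T) T = polar_point \<epsilon> (W 0) 0" by (simp add: W(3))
    then have "W T = W 0" using \<epsilon> norm_polar_point[OF \<epsilon>] by (metis exp_inj_iff mult_cancel_left less_irrefl)
    with eq have "cos T = 1" using \<epsilon> by (simp add: polar_point_def)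
    then obtain m :: int where m: "T = of_int m * 2 * pi" by (auto simp: cos_one_2pi_int)
    have "m > 0" using g(2) unfolding m by (simp add: zero_less_mult_iff)
    have "W (2 * pi) = W 0"
    proof (rule angular_solution_period[OF W(1) \<phi>])
      show "nat m > 0" using \<open>m > 0\<close> by simp
      have "2 * pi * real (nat m) = T" using \<open>m > 0\<close> by (simp add: m)
      then show "W (2 * pi * real (nat m)) = W 0" using \<open>W T = W 0\<close> by simp
    qed
    then have "W 0 = V 0" using unique[OF W' W0] V0 by simp
    then have "W t = V t" for t using angular_solution_unique[OF W(1) V(1) \<phi>, of 0 t] by simp
    then have "g' = \<gamma>" by (simp add: fun_eq_iff W(3) \<gamma>_def)
    moreover have "range g' = range g"
    proof -
      have "g t = g' (t - (t0 - \<tau>))" for t by (simp add: g'_def)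
      then have "range g \<subseteq> range g'" by (metis image_subsetI rangeI)
      moreover have "range g' \<subseteq> range g" by (auto simp: g'_def)
      ultimately show ?thesis by blast
    qed
    ultimately show ?thesis by (simp add: g(4) \<Gamma>_def)
  qed
  ultimately have limit: "limit_cycle ?F \<Gamma>"
    using periodic unfolding limit_cycle_def by blast
  define p where "p = (\<epsilon> * exp b, 0 :: real)"
  \<comment> \<open>the section coordinate \<open>s\<close> measures the radius in units of \<open>\<epsilon>\<close>, relative to \<open>e\<^sup>b\<close>\<close>
  define v where "v = (\<epsilon>, 0 :: real)"
  define P where "P s = exp (S (ln (exp b + s)) (2*pi)) - exp b" for s
  have sec: "p + s *\<^sub>R v = polar_point \<epsilon> (ln (exp b + s)) 0" if "\<bar>s\<bar> < exp b" for s
  proof -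
    have "exp b + s > 0" using that by linarith
    then show ?thesis by (simp add: p_def v_def polar_point_def algebra_simps)
  qed
  have dP: "(P has_real_derivative d) (at 0)"
  proof -
    have ln': "((\<lambda>s. ln (exp b + s)) has_real_derivative 1 / exp b) (at 0)"
      by (auto intro!: derivative_eq_intros)
    have "((\<lambda>a. S a (2*pi)) has_real_derivative d) (at (ln (exp b + 0)))" using d(1) by simp
    from DERIV_chain2[OF this ln']
    have "((\<lambda>s. S (ln (exp b + s)) (2*pi)) has_real_derivative d * (1 / exp b)) (at 0)" .
    from DERIV_diff[OF DERIV_chain2[OF DERIV_exp this] DERIV_const[of "exp b"]]
    show ?thesis unfolding P_def[abs_def] by (simp add: b(2))
  qed
  have P0: "P 0 = 0" by (simp add: P_def b(2))
  have "poincare_map ?F p v P"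
    unfolding poincare_map_def
  proof (intro conjI P0)
    define r where "r = exp b / 2"
    have r: "r > 0" "r < exp b" by (simp_all add: r_def)
    have "(P \<longlongrightarrow> 0) (at 0)" using DERIV_isCont[OF dP] P0 by (simp add: isCont_def)
    moreover have "((\<lambda>s. ln (exp b + s)) \<longlongrightarrow> b) (at 0)"
      by (rule tendsto_eq_intros refl | simp)+
    ultimately have "\<forall>\<^sub>F s in at 0. dist (P s) 0 < r \<and> dist (ln (exp b + s)) b < \<kappa> / 2"
      using r \<kappa> by (intro eventually_conj tendstoD) auto
    then obtain \<delta>' where \<delta>': "\<delta>' > 0"
      "\<And>s. s \<noteq> 0 \<Longrightarrow> \<bar>s\<bar> < \<delta>' \<Longrightarrow> \<bar>P s\<bar> < r \<and> \<bar>ln (exp b + s) - b\<bar> < \<kappa> / 2"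
      unfolding eventually_at by (auto simp: dist_real_def)
    define \<delta> where "\<delta> = min \<delta>' r"
    have pos: "fst z > 0 \<and> snd z = 0" if "z \<in> section_segment p v r" for z
    proof -
      from that obtain s where s: "s \<in> {-r<..<r}" "z = p + s *\<^sub>R v"
        unfolding section_segment_def by blast
      have "exp b + s > 0" using s(1) r(2) unfolding greaterThanLessThan_iff by linarith
      then have "\<epsilon> * (exp b + s) > 0" using \<epsilon> by simp
      then show ?thesis unfolding s(2) by (simp add: p_def v_def algebra_simps)
    qed
    have "transversal ?F v (section_segment p v r)"
      unfolding transversal_def
    proof
      fix z assume "z \<in> section_segment p v r"
      from pos[OF this] \<epsilon> show "fst (?F z) * snd v - snd (?F z) * fst v \<noteq> 0"
        by (simp add: v_def foci_field_def case_prod_unfold)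
    qed
    moreover have "first_return ?F p v r s (P s)" if s: "s \<in> {-\<delta><..<\<delta>}" for s
    proof -
      have "\<bar>s\<bar> < \<delta>" using s by auto
      then have s': "\<bar>s\<bar> < \<delta>'" "\<bar>s\<bar> < exp b" using r(2) by (simp_all add: \<delta>_def)
      let ?a = "ln (exp b + s)"
      have "\<bar>P s\<bar> < r \<and> \<bar>?a - b\<bar> < \<kappa> / 2"
        using \<delta>'(2)[OF _ s'(1)] P0 r \<kappa> by (cases "s = 0") simp_all
      then have Ps: "\<bar>P s\<bar> < r" and a: "\<bar>?a - b\<bar> < \<kappa> / 2" by simp_all
      have zone: "\<bar>?a - w0\<bar> < \<kappa>" using a b(1) by linarith
      let ?g = "\<lambda>t. polar_point \<epsilon> (S ?a t) t"
      have "angular_solution \<phi> (S ?a) {0..2*pi}"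
        by (rule angular_solution_subset[OF S(2)[OF zone]]) (use pi_less_4 in auto)
      then have "solution_on ?F {0..2*pi} ?g" by (rule angular_solution_imp_solution_on[OF _ \<epsilon>])
      moreover have "?g 0 = p + s *\<^sub>R v" using sec[OF s'(2)] S(1)[OF zone] by simp
      moreover have "?g (2*pi) = p + P s *\<^sub>R v"
        by (simp add: P_def p_def v_def polar_point_def algebra_simps)
      moreover have "?g t \<notin> section_segment p v r" if t: "t \<in> {0<..<2*pi}" for t
      proof
        assume "?g t \<in> section_segment p v r"
        from pos[OF this] have *: "\<epsilon> * exp (S ?a t) * cos t > 0" "\<epsilon> * exp (S ?a t) * sin t = 0"
          by (simp_all only: polar_point_def fst_conv snd_conv)
        have "\<epsilon> * exp (S ?a t) > 0" using \<epsilon> by simp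
        with * have "cos t > 0" by (blast intro: zero_less_mult_pos)
        moreover have "sin t = 0" using *(2) \<epsilon> by simp
        moreover have "t < pi \<or> t = pi \<or> t > pi" by linarith
        ultimately show False
          using t sin_gt_zero[of t] sin_lt_zero[of t] by auto
      qed
      ultimately show ?thesis
        unfolding first_return_def using Ps by (intro conjI exI[of _ ?g] exI[of _ "2*pi"]) auto
    qed
    moreover have "0 < \<delta>" "\<delta> \<le> r" using \<delta>' r by (auto simp: \<delta>_def)
    ultimately show "\<exists>r \<delta>. 0 < \<delta> \<and> \<delta> \<le> r \<and> transversal ?F v (section_segment p v r) \<and>
        (\<forall>s\<in>{-\<delta><..<\<delta>}. first_return ?F p v r s (P s))"
      by blast
  qed
  moreover have "p \<in> \<Gamma>"
  proof -
    have "p = \<gamma> 0" by (simp add: p_def \<gamma>_def V0 polar_point_def)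
    then show ?thesis by (simp add: \<Gamma>_def)
  qed
  ultimately have "hyperbolic_limit_cycle ?F \<Gamma>"
    unfolding hyperbolic_limit_cycle_def using limit dP d(2) by blast
  moreover have "\<epsilon> * exp (w0 - 1/2) < norm (\<gamma> t) \<and> norm (\<gamma> t) < \<epsilon> * exp (w0 + 1/2)" for t
  proof -
    have "w0 - 1/2 < V t" "V t < w0 + 1/2" using V_near[of t] \<kappa> by linarith+
    then show ?thesis using \<epsilon> by (simp add: norm_\<gamma>)
  qed
  ultimately show thesis
    by (intro that[of \<Gamma>]) (auto simp: \<Gamma>_def)
qed

section \<open>Arbitrarily many hyperbolic limit cycles\<close>

theorem theorem1:
  shows "\<exists>X Y :: real \<times> real \<Rightarrow> real \<Rightarrow> real \<times> real.
    affine_family X \<and> affine_family Y \<and>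
    (\<forall>k::nat. k > 0 \<longrightarrow>
      (\<exists>(\<phi> :: real \<Rightarrow> real) (\<epsilon>\<^sub>k :: real) (a :: real \<Rightarrow> real).
        non_monotonic_transition_function \<phi> \<and>
        card {t \<in> {-1<..<1}. critical_point \<phi> t} = 1 \<and>
        \<epsilon>\<^sub>k > 0 \<and> smooth_on {0..\<epsilon>\<^sub>k} a \<and> a 0 = 0 \<and>
        (\<forall>\<epsilon>\<in>{0<..\<epsilon>\<^sub>k}.
          \<exists>\<C>. finite \<C> \<and> card \<C> \<ge> k + 1 \<and>
            (\<forall>\<Gamma>\<in>\<C>. hyperbolic_limit_cycle
               (linear_regularization \<phi>
                  (\<lambda>z. X z (\<epsilon> * a \<epsilon>)) (\<lambda>z. Y z (\<epsilon> * a \<epsilon>)) \<epsilon>) \<Gamma>))))"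
proof -
  have smooth_const: "smooth_on A (\<lambda>_. c)" for A and c :: "'a :: real_normed_vector"
    unfolding smooth_on_def by (intro exI[of _ "\<lambda>n _. if n = 0 then c else 0"]) auto
  define X :: "real \<times> real \<Rightarrow> real \<Rightarrow> real \<times> real" where "X z \<alpha> = (case z of (x, y) \<Rightarrow> (x - y, x + y))" for z \<alpha>
  define Y :: "real \<times> real \<Rightarrow> real \<Rightarrow> real \<times> real" where "Y z \<alpha> = (case z of (x, y) \<Rightarrow> (- x - y, x - y))" for z \<alpha>
  have "affine_field (\<lambda>z. X z \<alpha>)" for \<alpha>
    unfolding affine_field_def X_def
    by (intro exI[of _ "\<lambda>(x, y). (x - y, x + y)"] exI[of _ 0] conjI linearI)
       (auto simp: algebra_simps)
  moreover have "smooth_on UNIV (X z)" for z unfolding X_def[abs_def] by (rule smooth_const)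
  ultimately have affX: "affine_family X" by (simp add: affine_family_def)
  have "affine_field (\<lambda>z. Y z \<alpha>)" for \<alpha>
    unfolding affine_field_def Y_def
    by (intro exI[of _ "\<lambda>(x, y). (- x - y, x - y)"] exI[of _ 0] conjI linearI)
       (auto simp: algebra_simps)
  moreover have "smooth_on UNIV (Y z)" for z unfolding Y_def[abs_def] by (rule smooth_const)
  ultimately have affY: "affine_family Y" by (simp add: affine_family_def)
  have "\<exists>(\<phi> :: real \<Rightarrow> real) (\<epsilon>\<^sub>k :: real) (a :: real \<Rightarrow> real).
        non_monotonic_transition_function \<phi> \<and>
        card {t \<in> {-1<..<1}. critical_point \<phi> t} = 1 \<and>
        \<epsilon>\<^sub>k > 0 \<and> smooth_on {0..\<epsilon>\<^sub>k} a \<and> a 0 = 0 \<and>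
        (\<forall>\<epsilon>\<in>{0<..\<epsilon>\<^sub>k}.
          \<exists>\<C>. finite \<C> \<and> card \<C> \<ge> k + 1 \<and>
            (\<forall>\<Gamma>\<in>\<C>. hyperbolic_limit_cycle
               (linear_regularization \<phi>
                  (\<lambda>z. X z (\<epsilon> * a \<epsilon>)) (\<lambda>z. Y z (\<epsilon> * a \<epsilon>)) \<epsilon>) \<Gamma>))" for k :: nat
  proof -
    \<comment> \<open>radii so small that an orbit stays inside the disc of radius \<open>1/2\<close> during one turn,
      with gaps of \<open>1\<close> between their logarithms\<close>
    define w :: "nat \<Rightarrow> real" where "w i = - 10 - real i" for i
    have "inj_on (\<lambda>i. exp (w i)) {..k}" by (auto simp: inj_on_def w_def)
    then obtain p where p: "\<And>x. \<bar>x\<bar> \<le> 1 \<Longrightarrow> poly (pderiv p) x > 0"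
      "\<And>i. i \<le> k \<Longrightarrow> circle_mean p (exp (w i)) = 0"
      "\<And>i. i \<le> k \<Longrightarrow> circle_mean (euler_derivative p) (exp (w i)) \<noteq> 0"
      using circle_mean_simple_zeros[of k "\<lambda>i. exp (w i)"] unfolding euler_derivative_def by auto
    have "\<exists>\<kappa> \<delta>1. 0 < \<kappa> \<and> \<kappa> \<le> 1/4 \<and> 0 < \<delta>1 \<and> (\<forall>\<delta> \<phi>. 0 < \<delta> \<longrightarrow> \<delta> \<le> \<delta>1 \<longrightarrow>
        (\<forall>x. \<bar>\<phi> x\<bar> \<le> 1) \<longrightarrow> (\<forall>x. \<bar>x\<bar> \<le> 1/2 \<longrightarrow> \<phi> x = \<delta> * poly p x) \<longrightarrow>
        hyperbolic_angular_cycle \<phi> (w i) \<kappa>)" if "i \<le> k" for i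
    proof -
      have "w i \<le> -10" by (simp add: w_def)
      from averaged_cycle[OF this p(2)[OF that] p(3)[OF that]] show ?thesis by metis
    qed
    then obtain \<kappa> \<delta>1 where cycle: "\<And>i. i \<le> k \<Longrightarrow> 0 < \<kappa> i \<and> \<kappa> i \<le> 1/4 \<and> 0 < \<delta>1 i"
      "\<And>i \<delta> \<phi>. i \<le> k \<Longrightarrow> 0 < \<delta> \<Longrightarrow> \<delta> \<le> \<delta>1 i \<Longrightarrow> \<forall>x. \<bar>\<phi> x\<bar> \<le> 1 \<Longrightarrow>
         \<forall>x. \<bar>x\<bar> \<le> 1/2 \<longrightarrow> \<phi> x = \<delta> * poly p x \<Longrightarrow> hyperbolic_angular_cycle \<phi> (w i) (\<kappa> i)"
      by metis
    obtain \<delta>0 where \<delta>0: "\<delta>0 > 0" "\<And>\<delta>. 0 < \<delta> \<Longrightarrow> \<delta> \<le> \<delta>0 \<Longrightarrow> \<exists>\<phi>.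
       non_monotonic_transition_function \<phi> \<and> card {t \<in> {-1<..<1}. critical_point \<phi> t} = 1 \<and>
       mono \<phi> \<and> (\<forall>x. \<bar>x\<bar> \<le> 1/2 \<longrightarrow> \<phi> x = \<delta> * poly p x)"
      by (rule transition_function_extending[of p, OF p(1)], assumption, rule that)
    define \<delta> where "\<delta> = Min (insert \<delta>0 (\<delta>1 ` {..k}))"
    have \<delta>_pos: "0 < \<delta>"
      unfolding \<delta>_def by (subst Min_gr_iff) (use \<delta>0(1) cycle(1) in auto)
    have \<delta>: "\<delta> \<le> \<delta>0" "\<And>i. i \<le> k \<Longrightarrow> \<delta> \<le> \<delta>1 i"
      unfolding \<delta>_def by (rule Min_le; simp)+
    obtain \<phi> where \<phi>: "non_monotonic_transition_function \<phi>"
      "card {t \<in> {-1<..<1}. critical_point \<phi> t} = 1" "mono \<phi>"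
      "\<forall>x. \<bar>x\<bar> \<le> 1/2 \<longrightarrow> \<phi> x = \<delta> * poly p x"
      using \<delta>0(2)[OF \<delta>_pos \<delta>(1)] by blast
    have trans: "transition_function \<phi>" using \<phi>(1) by (simp add: non_monotonic_transition_function_def)
    have le1: "\<bar>\<phi> x\<bar> \<le> 1" for x
    proof -
      have "\<phi> (min x (-1)) = -1" "\<phi> (max x 1) = 1" using trans by (simp_all add: transition_function_def)
      then show ?thesis
        using monoD[OF \<phi>(3), of "min x (-1)" x] monoD[OF \<phi>(3), of x "max x 1"] by (simp add: abs_le_iff)
    qed
    have "\<exists>\<C>. finite \<C> \<and> card \<C> \<ge> k + 1 \<and> (\<forall>\<Gamma>\<in>\<C>. hyperbolic_limit_cycle (foci_field \<phi> \<epsilon>) \<Gamma>)"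
      if \<epsilon>: "\<epsilon> > 0" for \<epsilon>
    proof -
      define Q where "Q i \<Gamma> \<longleftrightarrow> hyperbolic_limit_cycle (foci_field \<phi> \<epsilon>) \<Gamma> \<and> \<Gamma> \<noteq> {} \<and>
          \<Gamma> \<subseteq> {z. \<epsilon> * exp (w i - 1/2) < norm z \<and> norm z < \<epsilon> * exp (w i + 1/2)}" for i \<Gamma>
      have "\<exists>\<Gamma>. Q i \<Gamma>" if "i \<le> k" for i
      proof -
        have "hyperbolic_angular_cycle \<phi> (w i) (\<kappa> i)"
          using cycle(2)[OF that \<delta>_pos \<delta>(2)[OF that]] le1 \<phi>(4) by blast
        moreover have "0 < \<kappa> i" "\<kappa> i \<le> 1/4" using cycle(1)[OF that] by auto
        ultimately obtain \<Gamma> where "hyperbolic_limit_cycle (foci_field \<phi> \<epsilon>) \<Gamma>" "\<Gamma> \<noteq> {}"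
          "\<Gamma> \<subseteq> {z. \<epsilon> * exp (w i - 1/2) < norm z \<and> norm z < \<epsilon> * exp (w i + 1/2)}"
          by (rule foci_hyperbolic_limit_cycle[OF trans le1 _ _ _ \<epsilon>])
        then show ?thesis unfolding Q_def by blast
      qed
      then obtain \<Gamma> where "\<And>i. i \<le> k \<Longrightarrow> Q i (\<Gamma> i)" by metis
      then have \<Gamma>: "\<And>i. i \<le> k \<Longrightarrow> hyperbolic_limit_cycle (foci_field \<phi> \<epsilon>) (\<Gamma> i)"
        "\<And>i. i \<le> k \<Longrightarrow> \<Gamma> i \<noteq> {}"
        "\<And>i. i \<le> k \<Longrightarrow> \<Gamma> i \<subseteq> {z. \<epsilon> * exp (w i - 1/2) < norm z \<and> norm z < \<epsilon> * exp (w i + 1/2)}"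
        unfolding Q_def by blast+
      have "inj_on \<Gamma> {..k}"
      proof (rule inj_onI)
        fix i j assume ij: "i \<in> {..k}" "j \<in> {..k}" "\<Gamma> i = \<Gamma> j"
        then obtain z where "z \<in> \<Gamma> i" "z \<in> \<Gamma> j" using \<Gamma>(2)[of i] by auto
        with ij \<Gamma>(3)[of i] \<Gamma>(3)[of j]
        have "\<epsilon> * exp (w i - 1/2) < \<epsilon> * exp (w j + 1/2)" "\<epsilon> * exp (w j - 1/2) < \<epsilon> * exp (w i + 1/2)"
          by (auto intro: less_trans)
        then have "\<bar>real i - real j\<bar> < 1" using \<epsilon> by (simp add: w_def)
        then show "i = j" by linarith
      qed
      then show ?thesis
        using \<Gamma>(1) by (intro exI[of _ "\<Gamma> ` {..k}"]) (auto simp: card_image)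
    qed
    moreover have "linear_regularization \<phi> (\<lambda>z. X z \<alpha>) (\<lambda>z. Y z \<alpha>) \<epsilon> = foci_field \<phi> \<epsilon>" for \<alpha> \<epsilon>
      unfolding X_def Y_def linear_regularization_foci ..
    ultimately show ?thesis
      using \<phi>(1,2) by (intro exI[of _ \<phi>] exI[of _ 1] exI[of _ "\<lambda>_. 0"]) (auto intro: smooth_const)
  qed
  with affX affY show ?thesis by blast
qed

end
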